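(* Let $R$ be a commutative reduced Noetherian ring that is not a field. An injective $R$-module $E$ is bi-Hopfian if and only if $E \cong \bigoplus_{P} \left( \bigoplus_{n_P} E(R/P) \right)$, where the outer direct sum is taken over the minimal prime ideals $P$ of $R$ and the $n_P$ are non-negative integers.
   Context: All rings have $1 \neq 0$ and all modules are unital. An $R$-module $M$ is Hopfian if every surjective $R$-module endomorphism of $M$ is an isomorphism, co-Hopfian if every injective $R$-module endomorphism of $M$ is an isomorphism, and bi-Hopfian if it is both Hopfian and co-Hopfian. $E(M)$ denotes the injective envelope of the $R$-module $M$, and $\bigoplus_n M$ denotes the direct sum of $n$ copies of $M$. A ring is reduced if it has no nonzero nilpotent elements. *)

theory Defs
  imports "HOL-Algebra.Algebra"
begin

section \<open>Reduced rings and minimal primes\<close>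

definition reduced_ring :: "('a, 'k) ring_scheme \<Rightarrow> bool" where
  "reduced_ring R \<longleftrightarrow>
     (\<forall>x\<in>carrier R. \<forall>n::nat. x [^]\<^bsub>R\<^esub> n = \<zero>\<^bsub>R\<^esub> \<longrightarrow> x = \<zero>\<^bsub>R\<^esub>)"

definition minimal_primes :: "('a, 'k) ring_scheme \<Rightarrow> 'a set set" where
  "minimal_primes R =
     {P. primeideal P R \<and> (\<forall>Q. primeideal Q R \<and> Q \<subseteq> P \<longrightarrow> Q = P)}"


section \<open>Homomorphisms of modules\<close>

text \<open>As for \<^const>\<open>hom\<close> and \<^const>\<open>iso\<close>, maps are only constrained on the carrier.\<close>

definition mod_hom ::
    "('a, 'k) ring_scheme \<Rightarrow> ('a, 'm, 'p) module_scheme \<Rightarrow> ('a, 'n, 'q) module_scheme \<Rightarrow> ('m \<Rightarrow> 'n) set"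
  where
  "mod_hom R M N =
     {f \<in> carrier M \<rightarrow> carrier N.
        (\<forall>x\<in>carrier M. \<forall>y\<in>carrier M. f (x \<oplus>\<^bsub>M\<^esub> y) = f x \<oplus>\<^bsub>N\<^esub> f y) \<and>
        (\<forall>r\<in>carrier R. \<forall>x\<in>carrier M. f (r \<odot>\<^bsub>M\<^esub> x) = r \<odot>\<^bsub>N\<^esub> f x)}"

definition mod_iso ::
    "('a, 'k) ring_scheme \<Rightarrow> ('a, 'm, 'p) module_scheme \<Rightarrow> ('a, 'n, 'q) module_scheme \<Rightarrow> ('m \<Rightarrow> 'n) set"
  where
  "mod_iso R M N = {f \<in> mod_hom R M N. bij_betw f (carrier M) (carrier N)}"

definition is_mod_iso ::
    "('a, 'k) ring_scheme \<Rightarrow> ('a, 'm, 'p) module_scheme \<Rightarrow> ('a, 'n, 'q) module_scheme \<Rightarrow> bool"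
  where
  "is_mod_iso R M N \<longleftrightarrow> mod_iso R M N \<noteq> {}"


section \<open>Hopfian conditions\<close>

definition hopfian :: "('a, 'k) ring_scheme \<Rightarrow> ('a, 'm, 'p) module_scheme \<Rightarrow> bool" where
  "hopfian R M \<longleftrightarrow>
     (\<forall>f\<in>mod_hom R M M. f ` carrier M = carrier M \<longrightarrow> f \<in> mod_iso R M M)"

definition co_hopfian :: "('a, 'k) ring_scheme \<Rightarrow> ('a, 'm, 'p) module_scheme \<Rightarrow> bool" where
  "co_hopfian R M \<longleftrightarrow>
     (\<forall>f\<in>mod_hom R M M. inj_on f (carrier M) \<longrightarrow> f \<in> mod_iso R M M)"

definition bi_hopfian :: "('a, 'k) ring_scheme \<Rightarrow> ('a, 'm, 'p) module_scheme \<Rightarrow> bool" where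
  "bi_hopfian R M \<longleftrightarrow> hopfian R M \<and> co_hopfian R M"


section \<open>Quotients and direct sums\<close>

text \<open>The multiplicative structure of the module record plays no role in \<^locale>\<open>module\<close>.\<close>

definition quot_module :: "('a, 'k) ring_scheme \<Rightarrow> 'a set \<Rightarrow> ('a, 'a set) module" where
  "quot_module R I =
     \<lparr>carrier = carrier (R Quot I), monoid.mult = monoid.mult (R Quot I), one = \<one>\<^bsub>R Quot I\<^esub>,
      ring.zero = \<zero>\<^bsub>R Quot I\<^esub>, add = add (R Quot I),
      smult = (\<lambda>r Y. (I +>\<^bsub>R\<^esub> r) \<otimes>\<^bsub>R Quot I\<^esub> Y)\<rparr>"

definition module_direct_sum :: "'i set \<Rightarrow> ('i \<Rightarrow> ('a, 'm, 'p) module_scheme) \<Rightarrow> ('a, 'i \<Rightarrow> 'm) module" where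
  "module_direct_sum I M =
     \<lparr>carrier = {x \<in> \<Pi>\<^sub>E i\<in>I. carrier (M i). finite {i \<in> I. x i \<noteq> \<zero>\<^bsub>M i\<^esub>}},
      monoid.mult = undefined, one = undefined,
      ring.zero = (\<lambda>i\<in>I. \<zero>\<^bsub>M i\<^esub>),
      add = (\<lambda>x y. \<lambda>i\<in>I. x i \<oplus>\<^bsub>M i\<^esub> y i),
      smult = (\<lambda>r x. \<lambda>i\<in>I. r \<odot>\<^bsub>M i\<^esub> x i)\<rparr>"


section \<open>Injective modules and injective envelopes\<close>

text \<open>
  A formula cannot quantify over types, so the test modules \<^term>\<open>A\<close>, \<^term>\<open>B\<close> below have their
  carriers in the element type of the ring. By the Baer argument this is no restriction:
  see \<open>injective_module_extends\<close> below, where \<^term>\<open>A\<close> and \<^term>\<open>B\<close> have arbitrary types.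
\<close>

definition injective_module :: "('a, 'k) ring_scheme \<Rightarrow> ('a, 'm, 'p) module_scheme \<Rightarrow> bool" where
  "injective_module R E \<longleftrightarrow> module R E \<and>
     (\<forall>(A :: ('a, 'a) module) (B :: ('a, 'a) module) f g.
        module R A \<and> module R B \<and>
        f \<in> mod_hom R A B \<and> inj_on f (carrier A) \<and> g \<in> mod_hom R A E \<longrightarrow>
        (\<exists>h\<in>mod_hom R B E. \<forall>x\<in>carrier A. h (f x) = g x))"

definition essential_embedding ::
    "('a, 'k) ring_scheme \<Rightarrow> ('a, 'm, 'p) module_scheme \<Rightarrow> ('a, 'n, 'q) module_scheme \<Rightarrow> ('m \<Rightarrow> 'n) \<Rightarrow> bool"
  where
  "essential_embedding R M E j \<longleftrightarrow>
     j \<in> mod_hom R M E \<and> inj_on j (carrier M) \<and>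
     (\<forall>N. submodule N R E \<and> N \<noteq> {\<zero>\<^bsub>E\<^esub>} \<longrightarrow> N \<inter> j ` carrier M \<noteq> {\<zero>\<^bsub>E\<^esub>})"

definition injective_envelope ::
    "('a, 'k) ring_scheme \<Rightarrow> ('a, 'm, 'p) module_scheme \<Rightarrow> ('a, 'n, 'q) module_scheme \<Rightarrow> bool"
  where
  "injective_envelope R M E \<longleftrightarrow>
     injective_module R E \<and> (\<exists>j. essential_embedding R M E j)"


section \<open>Well-definedness of the constructions\<close>

lemma (in ideal) quot_module_is_module:
  assumes "cring R"
  shows "module R (quot_module R I)"
proof -
  interpret Q: cring "R Quot I"
    by (rule quotient_is_cring[OF assms])
  have coset: "I +> r \<in> carrier (R Quot I)" if "r \<in> carrier R" for r
    using that by (auto simp: FactRing_def A_RCOSETS_def')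
  note h = rcos_ring_hom
  have addh: "I +> (r \<oplus> s) = (I +> r) \<oplus>\<^bsub>R Quot I\<^esub> (I +> s)"
    and multh: "I +> (r \<otimes> s) = (I +> r) \<otimes>\<^bsub>R Quot I\<^esub> (I +> s)"
    if "r \<in> carrier R" "s \<in> carrier R" for r s
    using ring_hom_add[OF h that] ring_hom_mult[OF h that] by auto
  have oneh: "I +> \<one> = \<one>\<^bsub>R Quot I\<^esub>"
    using ring_hom_one[OF h] .
  have simps:
    "carrier (quot_module R I) = carrier (R Quot I)"
    "add (quot_module R I) = add (R Quot I)"
    "\<zero>\<^bsub>quot_module R I\<^esub> = \<zero>\<^bsub>R Quot I\<^esub>"
    "smult (quot_module R I) = (\<lambda>r Y. (I +> r) \<otimes>\<^bsub>R Quot I\<^esub> Y)"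
    by (simp_all add: quot_module_def)
  show ?thesis
  proof (rule moduleI)
    show "abelian_group (quot_module R I)"
    proof (rule abelian_groupI, unfold simps)
      fix x assume "x \<in> carrier (R Quot I)"
      then show "\<exists>y\<in>carrier (R Quot I). y \<oplus>\<^bsub>R Quot I\<^esub> x = \<zero>\<^bsub>R Quot I\<^esub>"
        using Q.l_neg Q.a_inv_closed by blast
    qed (simp_all add: Q.a_ac)
  qed (use assms in \<open>auto simp: simps coset addh multh oneh Q.l_distr Q.r_distr Q.m_assoc\<close>)
qed

lemma module_direct_sum_is_module:
  assumes R: "cring R" and M: "\<And>i. i \<in> I \<Longrightarrow> module R (M i)"
  shows "module R (module_direct_sum I M)"
proof -
  have ab: "abelian_group (M i)" if "i \<in> I" for i
    using M[OF that] by (rule module.axioms)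
  have c2: "x \<oplus>\<^bsub>M i\<^esub> y \<in> carrier (M i)" "x \<oplus>\<^bsub>M i\<^esub> y = y \<oplus>\<^bsub>M i\<^esub> x"
    if "i \<in> I" "x \<in> carrier (M i)" "y \<in> carrier (M i)" for i x y
  proof -
    interpret N: module R "M i" using M[OF that(1)] .
    show "x \<oplus>\<^bsub>M i\<^esub> y \<in> carrier (M i)" "x \<oplus>\<^bsub>M i\<^esub> y = y \<oplus>\<^bsub>M i\<^esub> x"
      using that N.M.a_comm by simp_all
  qed
  have c1: "\<zero>\<^bsub>M i\<^esub> \<oplus>\<^bsub>M i\<^esub> x = x" "\<ominus>\<^bsub>M i\<^esub> x \<in> carrier (M i)" "\<ominus>\<^bsub>M i\<^esub> x \<oplus>\<^bsub>M i\<^esub> x = \<zero>\<^bsub>M i\<^esub>"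
      "r \<in> carrier R \<Longrightarrow> r \<odot>\<^bsub>M i\<^esub> x \<in> carrier (M i)"
    if "i \<in> I" "x \<in> carrier (M i)" for i x r
  proof -
    interpret N: module R "M i" using M[OF that(1)] .
    show "\<zero>\<^bsub>M i\<^esub> \<oplus>\<^bsub>M i\<^esub> x = x" "\<ominus>\<^bsub>M i\<^esub> x \<in> carrier (M i)" "\<ominus>\<^bsub>M i\<^esub> x \<oplus>\<^bsub>M i\<^esub> x = \<zero>\<^bsub>M i\<^esub>"
      "r \<in> carrier R \<Longrightarrow> r \<odot>\<^bsub>M i\<^esub> x \<in> carrier (M i)"
      using that N.M.l_neg by simp_all
  qed
  have z: "\<zero>\<^bsub>M i\<^esub> \<in> carrier (M i)" if "i \<in> I" for i
    using abelian_monoid.zero_closed[OF abelian_group.axioms(1)[OF ab[OF that]]] .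
  have neg0: "\<ominus>\<^bsub>M i\<^esub> \<zero>\<^bsub>M i\<^esub> = \<zero>\<^bsub>M i\<^esub>" if "i \<in> I" for i
    using c2(2)[OF that] c1(1-3)[OF that] z[OF that] by metis
  have sm0: "r \<odot>\<^bsub>M i\<^esub> \<zero>\<^bsub>M i\<^esub> = \<zero>\<^bsub>M i\<^esub>" if "i \<in> I" "r \<in> carrier R" for i r
    using module.smult_r_null[OF M] that by blast
  let ?D = "module_direct_sum I M"
  have fin_add: "finite {i \<in> I. x i \<oplus>\<^bsub>M i\<^esub> y i \<noteq> \<zero>\<^bsub>M i\<^esub>}"
    if "x \<in> carrier ?D" "y \<in> carrier ?D" for x y
  proof (rule finite_subset)
    show "finite ({i \<in> I. x i \<noteq> \<zero>\<^bsub>M i\<^esub>} \<union> {i \<in> I. y i \<noteq> \<zero>\<^bsub>M i\<^esub>})"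
      using that by (simp add: module_direct_sum_def)
  qed (use c1(1) z in auto)
  have fin_sm: "finite {i \<in> I. r \<odot>\<^bsub>M i\<^esub> x i \<noteq> \<zero>\<^bsub>M i\<^esub>}"
    if "r \<in> carrier R" "x \<in> carrier ?D" for r x
  proof (rule finite_subset)
    show "finite {i \<in> I. x i \<noteq> \<zero>\<^bsub>M i\<^esub>}"
      using that by (simp add: module_direct_sum_def)
  qed (use sm0 that in auto)
  have fin_neg: "finite {i \<in> I. \<ominus>\<^bsub>M i\<^esub> x i \<noteq> \<zero>\<^bsub>M i\<^esub>}"
    if "x \<in> carrier ?D" for x
  proof (rule finite_subset)
    show "finite {i \<in> I. x i \<noteq> \<zero>\<^bsub>M i\<^esub>}"
      using that by (simp add: module_direct_sum_def)
  qed (use neg0 that in auto)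
  have car: "x i \<in> carrier (M i)" if "x \<in> carrier ?D" "i \<in> I" for x i
    using that by (auto simp: module_direct_sum_def)
  have mem: "(\<lambda>i\<in>I. g i) \<in> carrier ?D \<longleftrightarrow>
      (\<forall>i\<in>I. g i \<in> carrier (M i)) \<and> finite {i \<in> I. g i \<noteq> \<zero>\<^bsub>M i\<^esub>}" for g
    by (auto simp: module_direct_sum_def cong: conj_cong)
  have ext: "x = y" if "x \<in> carrier ?D" "y \<in> carrier ?D" "\<And>i. i \<in> I \<Longrightarrow> x i = y i" for x y
    using that by (auto simp: module_direct_sum_def intro: PiE_ext)
  have op: "add ?D = (\<lambda>x y. \<lambda>i\<in>I. x i \<oplus>\<^bsub>M i\<^esub> y i)"
      "\<zero>\<^bsub>?D\<^esub> = (\<lambda>i\<in>I. \<zero>\<^bsub>M i\<^esub>)" "smult ?D = (\<lambda>r x. \<lambda>i\<in>I. r \<odot>\<^bsub>M i\<^esub> x i)"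
    by (simp_all add: module_direct_sum_def)
  have addc: "x \<oplus>\<^bsub>?D\<^esub> y \<in> carrier ?D" if "x \<in> carrier ?D" "y \<in> carrier ?D" for x y
    using that fin_add[OF that] c1 c2 car by (simp add: op mem)
  have smc: "r \<odot>\<^bsub>?D\<^esub> x \<in> carrier ?D" if "r \<in> carrier R" "x \<in> carrier ?D" for r x
    using that fin_sm[OF that] c1 c2 car by (simp add: op mem)
  have zc: "\<zero>\<^bsub>?D\<^esub> \<in> carrier ?D"
    using z by (simp add: op mem)
  show ?thesis
  proof (rule moduleI[OF R])
    show "abelian_group ?D"
    proof (rule abelian_groupI)
      fix x y w assume xyw: "x \<in> carrier ?D" "y \<in> carrier ?D" "w \<in> carrier ?D"
      show "x \<oplus>\<^bsub>?D\<^esub> y \<oplus>\<^bsub>?D\<^esub> w = x \<oplus>\<^bsub>?D\<^esub> (y \<oplus>\<^bsub>?D\<^esub> w)"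
        by (rule ext, (use xyw in \<open>simp_all add: addc smc zc\<close>)[2])
        (use xyw car in \<open>simp add: op abelian_monoid.a_assoc[OF abelian_group.axioms(1)[OF ab]]\<close>)
    next
      fix x y assume xy: "x \<in> carrier ?D" "y \<in> carrier ?D"
      show "x \<oplus>\<^bsub>?D\<^esub> y = y \<oplus>\<^bsub>?D\<^esub> x"
        by (rule ext, (use xy in \<open>simp_all add: addc smc zc\<close>)[2])
        (use xy car c1 c2 in \<open>simp add: op\<close>)
    next
      fix x assume x: "x \<in> carrier ?D"
      show "\<zero>\<^bsub>?D\<^esub> \<oplus>\<^bsub>?D\<^esub> x = x"
        by (rule ext, (use x in \<open>simp_all add: addc smc zc\<close>)[2])
        (use x car c1 c2 in \<open>simp add: op\<close>)
      have n: "(\<lambda>i\<in>I. \<ominus>\<^bsub>M i\<^esub> x i) \<in> carrier ?D"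
        using x fin_neg[OF x] c1 c2 car by (simp add: mem)
      moreover have "(\<lambda>i\<in>I. \<ominus>\<^bsub>M i\<^esub> x i) \<oplus>\<^bsub>?D\<^esub> x = \<zero>\<^bsub>?D\<^esub>"
        by (rule ext, (use x n in \<open>simp_all add: addc smc zc\<close>)[2])
        (use x n car c1 c2 in \<open>simp add: op\<close>)
      ultimately show "\<exists>y\<in>carrier ?D. y \<oplus>\<^bsub>?D\<^esub> x = \<zero>\<^bsub>?D\<^esub>"
        by blast
    qed (use addc zc in auto)
  next
    fix r s x assume rsx: "r \<in> carrier R" "s \<in> carrier R" "x \<in> carrier ?D"
    interpret cring R by fact
    show "(r \<oplus>\<^bsub>R\<^esub> s) \<odot>\<^bsub>?D\<^esub> x = (r \<odot>\<^bsub>?D\<^esub> x) \<oplus>\<^bsub>?D\<^esub> (s \<odot>\<^bsub>?D\<^esub> x)"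
      by (rule ext, (use rsx in \<open>simp_all add: addc smc zc\<close>)[2])
        (use rsx car in \<open>simp add: op module.smult_l_distr[OF M]\<close>)
    show "(r \<otimes>\<^bsub>R\<^esub> s) \<odot>\<^bsub>?D\<^esub> x = r \<odot>\<^bsub>?D\<^esub> (s \<odot>\<^bsub>?D\<^esub> x)"
      by (rule ext, (use rsx in \<open>simp_all add: addc smc zc\<close>)[2])
        (use rsx car in \<open>simp add: op module.smult_assoc1[OF M]\<close>)
  next
    fix r x y assume rxy: "r \<in> carrier R" "x \<in> carrier ?D" "y \<in> carrier ?D"
    show "r \<odot>\<^bsub>?D\<^esub> (x \<oplus>\<^bsub>?D\<^esub> y) = (r \<odot>\<^bsub>?D\<^esub> x) \<oplus>\<^bsub>?D\<^esub> (r \<odot>\<^bsub>?D\<^esub> y)"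
      by (rule ext, (use rxy in \<open>simp_all add: addc smc zc\<close>)[2])
        (use rxy car in \<open>simp add: op module.smult_r_distr[OF M]\<close>)
  next
    fix x assume x: "x \<in> carrier ?D"
    interpret cring R by fact
    show "\<one>\<^bsub>R\<^esub> \<odot>\<^bsub>?D\<^esub> x = x"
      by (rule ext, (use x in \<open>simp_all add: addc smc zc\<close>)[2])
        (use x car in \<open>simp add: op module.smult_one[OF M]\<close>)
  qed (use smc in auto)
qed


section \<open>Injectivity against modules of arbitrary type\<close>

lemma injective_module_extends:
  fixes R :: "('a, 'k) ring_scheme" and E :: "('a, 'm, 'p) module_scheme"
    and A :: "('a, 'x, 'q) module_scheme" and B :: "('a, 'y, 'r) module_scheme"
  assumes E: "injective_module R E" and A: "module R A" and B: "module R B"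
    and f: "f \<in> mod_hom R A B" "inj_on f (carrier A)" and g: "g \<in> mod_hom R A E"
  shows "\<exists>h\<in>mod_hom R B E. \<forall>x\<in>carrier A. h (f x) = g x"
proof -
  interpret E: module R E using E by (simp add: injective_module_def)
  interpret A: module R A by fact
  interpret B: module R B by fact
  define pg where "pg G \<longleftrightarrow> G \<subseteq> carrier B \<times> carrier E \<and> (\<lambda>a. (f a, g a)) ` carrier A \<subseteq> G \<and>
      (\<forall>x y u v. (x, u) \<in> G \<and> (y, v) \<in> G \<longrightarrow> (x \<oplus>\<^bsub>B\<^esub> y, u \<oplus>\<^bsub>E\<^esub> v) \<in> G) \<and>
      (\<forall>r x u. r \<in> carrier R \<and> (x, u) \<in> G \<longrightarrow> (r \<odot>\<^bsub>B\<^esub> x, r \<odot>\<^bsub>E\<^esub> u) \<in> G) \<and>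
      (\<forall>u. (\<zero>\<^bsub>B\<^esub>, u) \<in> G \<longrightarrow> u = \<zero>\<^bsub>E\<^esub>)" for G
  have f0: "f \<zero>\<^bsub>A\<^esub> = \<zero>\<^bsub>B\<^esub>" and g0: "g \<zero>\<^bsub>A\<^esub> = \<zero>\<^bsub>E\<^esub>"
  proof -
    have "f (\<zero>\<^bsub>R\<^esub> \<odot>\<^bsub>A\<^esub> \<zero>\<^bsub>A\<^esub>) = \<zero>\<^bsub>R\<^esub> \<odot>\<^bsub>B\<^esub> f \<zero>\<^bsub>A\<^esub>" "f \<zero>\<^bsub>A\<^esub> \<in> carrier B"
      using f(1) A.M.zero_closed unfolding mod_hom_def by blast+
    then show "f \<zero>\<^bsub>A\<^esub> = \<zero>\<^bsub>B\<^esub>" by simp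
    have "g (\<zero>\<^bsub>R\<^esub> \<odot>\<^bsub>A\<^esub> \<zero>\<^bsub>A\<^esub>) = \<zero>\<^bsub>R\<^esub> \<odot>\<^bsub>E\<^esub> g \<zero>\<^bsub>A\<^esub>" "g \<zero>\<^bsub>A\<^esub> \<in> carrier E"
      using g A.M.zero_closed unfolding mod_hom_def by blast+
    then show "g \<zero>\<^bsub>A\<^esub> = \<zero>\<^bsub>E\<^esub>" by simp
  qed
  let ?G0 = "(\<lambda>a. (f a, g a)) ` carrier A"
  have pg0: "pg ?G0"
    unfolding pg_def
  proof (intro conjI allI impI)
    show "?G0 \<subseteq> carrier B \<times> carrier E"
      using f(1) g by (auto simp: mod_hom_def)
    show "(x \<oplus>\<^bsub>B\<^esub> y, u \<oplus>\<^bsub>E\<^esub> v) \<in> ?G0" if "(x, u) \<in> ?G0 \<and> (y, v) \<in> ?G0" for x y u v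
    proof -
      from that obtain a b where ab: "a \<in> carrier A" "b \<in> carrier A"
        "x = f a" "u = g a" "y = f b" "v = g b" by auto
      then show ?thesis
        using f(1) g by (intro image_eqI[of _ _ "a \<oplus>\<^bsub>A\<^esub> b"]) (auto simp: mod_hom_def)
    qed
    show "(r \<odot>\<^bsub>B\<^esub> x, r \<odot>\<^bsub>E\<^esub> u) \<in> ?G0" if "r \<in> carrier R \<and> (x, u) \<in> ?G0" for r x u
    proof -
      from that obtain a where "a \<in> carrier A" "x = f a" "u = g a" by auto
      then show ?thesis
        using that f(1) g by (intro image_eqI[of _ _ "r \<odot>\<^bsub>A\<^esub> a"]) (auto simp: mod_hom_def)
    qed
    show "u = \<zero>\<^bsub>E\<^esub>" if "(\<zero>\<^bsub>B\<^esub>, u) \<in> ?G0" for u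
    proof -
      from that obtain a where a: "a \<in> carrier A" "\<zero>\<^bsub>B\<^esub> = f a" "u = g a" by auto
      then have "a = \<zero>\<^bsub>A\<^esub>" using f(2) f0 A.M.zero_closed by (metis inj_onD)
      then show ?thesis using a g0 by simp
    qed
  qed simp
  have "\<exists>G\<in>Collect pg. \<forall>Y\<in>Collect pg. G \<subseteq> Y \<longrightarrow> Y = G"
  proof (rule subset_Zorn_nonempty)
    fix C assume C: "C \<noteq> {}" "subset.chain (Collect pg) C"
    then have Cpg: "\<And>G. G \<in> C \<Longrightarrow> pg G" and lin: "\<And>G H. G \<in> C \<Longrightarrow> H \<in> C \<Longrightarrow> G \<subseteq> H \<or> H \<subseteq> G"
      by (auto simp: subset_chain_def)
    have "pg (\<Union>C)"
      unfolding pg_def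
    proof (intro conjI allI impI)
      show "(x \<oplus>\<^bsub>B\<^esub> y, u \<oplus>\<^bsub>E\<^esub> v) \<in> \<Union>C" if hyp: "(x, u) \<in> \<Union>C \<and> (y, v) \<in> \<Union>C" for x y u v
      proof -
        from hyp obtain G H where GH: "G \<in> C" "H \<in> C" "(x, u) \<in> G" "(y, v) \<in> H" by auto
        then obtain K where "K \<in> C" "(x, u) \<in> K" "(y, v) \<in> K" using lin[of G H] by blast
        then show ?thesis using Cpg[of K] unfolding pg_def by blast
      qed
    next
      show "\<Union>C \<subseteq> carrier B \<times> carrier E" using Cpg unfolding pg_def by blast
      show "?G0 \<subseteq> \<Union>C" using Cpg C(1) unfolding pg_def by blast
      show "(r \<odot>\<^bsub>B\<^esub> x, r \<odot>\<^bsub>E\<^esub> u) \<in> \<Union>C" if "r \<in> carrier R \<and> (x, u) \<in> \<Union>C" for r x u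
        using that Cpg unfolding pg_def by blast
      show "u = \<zero>\<^bsub>E\<^esub>" if "(\<zero>\<^bsub>B\<^esub>, u) \<in> \<Union>C" for u
        using that Cpg unfolding pg_def by blast
    qed
    then show "\<Union>C \<in> Collect pg" by simp
  qed (use pg0 in auto)
  then obtain G where G: "pg G" and max: "\<And>Y. pg Y \<Longrightarrow> G \<subseteq> Y \<Longrightarrow> Y = G" by auto
  have Gsub: "x \<in> carrier B" "u \<in> carrier E" if "(x, u) \<in> G" for x u
    using G that unfolding pg_def by auto
  have Gf: "(f a, g a) \<in> G" if "a \<in> carrier A" for a
    using G that unfolding pg_def by auto
  have Gadd: "(x \<oplus>\<^bsub>B\<^esub> y, u \<oplus>\<^bsub>E\<^esub> v) \<in> G" if "(x, u) \<in> G" "(y, v) \<in> G" for x y u v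
    using G that unfolding pg_def by blast
  have Gsm: "(r \<odot>\<^bsub>B\<^esub> x, r \<odot>\<^bsub>E\<^esub> u) \<in> G" if "r \<in> carrier R" "(x, u) \<in> G" for r x u
    using G that unfolding pg_def by blast
  have Gz: "u = \<zero>\<^bsub>E\<^esub>" if "(\<zero>\<^bsub>B\<^esub>, u) \<in> G" for u
    using G that unfolding pg_def by blast
  have G00: "(\<zero>\<^bsub>B\<^esub>, \<zero>\<^bsub>E\<^esub>) \<in> G"
    using Gf[of "\<zero>\<^bsub>A\<^esub>"] f0 g0 by simp
  have Gneg: "(\<ominus>\<^bsub>B\<^esub> x, \<ominus>\<^bsub>E\<^esub> u) \<in> G" if "(x, u) \<in> G" for x u
    using Gsm[of "\<ominus>\<^bsub>R\<^esub> \<one>\<^bsub>R\<^esub>" x u] that Gsub[OF that]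
    by (simp add: B.smult_l_minus E.smult_l_minus)
  have Guniq: "u = v" if "(x, u) \<in> G" "(x, v) \<in> G" for x u v
  proof -
    have "(x \<oplus>\<^bsub>B\<^esub> \<ominus>\<^bsub>B\<^esub> x, u \<oplus>\<^bsub>E\<^esub> \<ominus>\<^bsub>E\<^esub> v) \<in> G"
      using that Gadd Gneg by blast
    then have "u \<oplus>\<^bsub>E\<^esub> \<ominus>\<^bsub>E\<^esub> v = \<zero>\<^bsub>E\<^esub>"
      using Gz Gsub that by (simp add: B.M.r_neg)
    then show ?thesis
      using Gsub that by (metis E.M.minus_equality E.M.minus_minus E.M.a_inv_closed E.M.a_comm)
  qed
  have dom: "\<exists>u. (b, u) \<in> G" if b: "b \<in> carrier B" for b
  proof -
    define I where "I = {r \<in> carrier R. \<exists>u. (r \<odot>\<^bsub>B\<^esub> b, u) \<in> G}"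
    define \<phi> where "\<phi> r = (THE u. (r \<odot>\<^bsub>B\<^esub> b, u) \<in> G)" for r
    have \<phi>G: "(r \<odot>\<^bsub>B\<^esub> b, \<phi> r) \<in> G" if "r \<in> I" for r
    proof -
      from that obtain u where u: "(r \<odot>\<^bsub>B\<^esub> b, u) \<in> G" unfolding I_def by auto
      show ?thesis unfolding \<phi>_def by (rule theI[of _ u]) (use u Guniq in auto)
    qed
    have IR: "I \<subseteq> carrier R" unfolding I_def by auto
    have Iadd: "r \<oplus>\<^bsub>R\<^esub> s \<in> I" "\<phi> (r \<oplus>\<^bsub>R\<^esub> s) = \<phi> r \<oplus>\<^bsub>E\<^esub> \<phi> s" if "r \<in> I" "s \<in> I" for r s
    proof -
      have 1: "((r \<oplus>\<^bsub>R\<^esub> s) \<odot>\<^bsub>B\<^esub> b, \<phi> r \<oplus>\<^bsub>E\<^esub> \<phi> s) \<in> G"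
        using Gadd[OF \<phi>G[OF that(1)] \<phi>G[OF that(2)]] that IR b B.smult_l_distr by (metis subsetD)
      then show 2: "r \<oplus>\<^bsub>R\<^esub> s \<in> I" using that IR unfolding I_def by blast
      show "\<phi> (r \<oplus>\<^bsub>R\<^esub> s) = \<phi> r \<oplus>\<^bsub>E\<^esub> \<phi> s" using Guniq[OF \<phi>G[OF 2] 1] .
    qed
    have Imul: "r \<otimes>\<^bsub>R\<^esub> s \<in> I" "\<phi> (r \<otimes>\<^bsub>R\<^esub> s) = r \<odot>\<^bsub>E\<^esub> \<phi> s" if "r \<in> carrier R" "s \<in> I" for r s
    proof -
      have 1: "((r \<otimes>\<^bsub>R\<^esub> s) \<odot>\<^bsub>B\<^esub> b, r \<odot>\<^bsub>E\<^esub> \<phi> s) \<in> G"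
        using Gsm[OF that(1) \<phi>G[OF that(2)]] that IR b B.smult_assoc1 by (metis subsetD)
      then show 2: "r \<otimes>\<^bsub>R\<^esub> s \<in> I" using that IR unfolding I_def by blast
      show "\<phi> (r \<otimes>\<^bsub>R\<^esub> s) = r \<odot>\<^bsub>E\<^esub> \<phi> s" using Guniq[OF \<phi>G[OF 2] 1] .
    qed
    have I0: "\<zero>\<^bsub>R\<^esub> \<in> I" unfolding I_def using G00 b by auto
    define RR :: "('a, 'a) module" where
      "RR = \<lparr>carrier = carrier R, monoid.mult = monoid.mult R, one = \<one>\<^bsub>R\<^esub>, ring.zero = \<zero>\<^bsub>R\<^esub>, add = add R,
        smult = monoid.mult R\<rparr>"
    have RR: "module R RR"
    proof (rule moduleI)
      show "abelian_group RR"
        by (rule abelian_groupI)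
          (auto simp: RR_def E.R.a_ac intro: bexI[of _ "\<ominus>\<^bsub>R\<^esub> _"] E.R.l_neg)
    qed (use E.R.is_cring in \<open>auto simp: RR_def E.R.l_distr E.R.r_distr E.R.m_assoc\<close>)
    interpret RR: module R RR by fact
    have subI: "submodule I R RR"
    proof (rule RR.submoduleI)
      fix a assume a: "a \<in> I"
      then have "(\<ominus>\<^bsub>R\<^esub> \<one>\<^bsub>R\<^esub>) \<odot>\<^bsub>RR\<^esub> a \<in> I"
        using Imul(1)[of "\<ominus>\<^bsub>R\<^esub> \<one>\<^bsub>R\<^esub>" a] by (simp add: RR_def)
      moreover have "a \<in> carrier RR" using a IR by (auto simp: RR_def)
      ultimately show "\<ominus>\<^bsub>RR\<^esub> a \<in> I"
        by (simp add: RR.smult_l_minus)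
    qed (use IR I0 Iadd Imul in \<open>auto simp: RR_def\<close>)
    have RI: "module R (RR\<lparr>carrier := I\<rparr>)"
      using submodule.submodule_is_module[OF subI RR] .
    have "(\<lambda>x. x) \<in> mod_hom R (RR\<lparr>carrier := I\<rparr>) RR"
      using IR by (auto simp: mod_hom_def RR_def)
    moreover have "\<phi> \<in> mod_hom R (RR\<lparr>carrier := I\<rparr>) E"
      using Iadd Imul Gsub(2)[OF \<phi>G] by (auto simp: mod_hom_def RR_def)
    moreover have "inj_on (\<lambda>x. x) (carrier (RR\<lparr>carrier := I\<rparr>))" by simp
    ultimately obtain \<psi> where \<psi>: "\<psi> \<in> mod_hom R RR E" "\<And>r. r \<in> I \<Longrightarrow> \<psi> r = \<phi> r"
      using E RI RR unfolding injective_module_def by (fastforce)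
    define e where "e = \<psi> \<one>\<^bsub>R\<^esub>"
    have e: "e \<in> carrier E" using \<psi>(1) by (auto simp: e_def mod_hom_def RR_def)
    have \<phi>e: "\<phi> r = r \<odot>\<^bsub>E\<^esub> e" if "r \<in> I" for r
    proof -
      have r: "r \<in> carrier R" using that IR by auto
      then have "\<psi> (r \<otimes>\<^bsub>R\<^esub> \<one>\<^bsub>R\<^esub>) = r \<odot>\<^bsub>E\<^esub> \<psi> \<one>\<^bsub>R\<^esub>"
        using \<psi>(1) E.R.one_closed by (simp add: mod_hom_def RR_def del: E.R.r_one)
      then show ?thesis using \<psi>(2)[OF that] r by (simp add: e_def)
    qed
    define G' where "G' = {(x \<oplus>\<^bsub>B\<^esub> r \<odot>\<^bsub>B\<^esub> b, u \<oplus>\<^bsub>E\<^esub> r \<odot>\<^bsub>E\<^esub> e) | x u r. (x, u) \<in> G \<and> r \<in> carrier R}"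
    have G'I: "(x \<oplus>\<^bsub>B\<^esub> r \<odot>\<^bsub>B\<^esub> b, u \<oplus>\<^bsub>E\<^esub> r \<odot>\<^bsub>E\<^esub> e) \<in> G'" if "(x, u) \<in> G" "r \<in> carrier R" for x u r
      using that unfolding G'_def by blast
    have GG': "G \<subseteq> G'"
    proof clarify
      fix x u assume xu: "(x, u) \<in> G"
      show "(x, u) \<in> G'"
        using G'I[OF xu E.R.zero_closed] Gsub[OF xu] b e by simp
    qed
    have "pg G'"
      unfolding pg_def
    proof (intro conjI allI impI)
      show "G' \<subseteq> carrier B \<times> carrier E"
        using Gsub b e unfolding G'_def by auto
      show "?G0 \<subseteq> G'" using Gf GG' by blast
      show "(p \<oplus>\<^bsub>B\<^esub> q, y \<oplus>\<^bsub>E\<^esub> z) \<in> G'" if hyp: "(p, y) \<in> G' \<and> (q, z) \<in> G'" for p q y z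
      proof -
        from hyp obtain x u r x' u' r' where
          xu: "(x, u) \<in> G" "r \<in> carrier R" "p = x \<oplus>\<^bsub>B\<^esub> r \<odot>\<^bsub>B\<^esub> b" "y = u \<oplus>\<^bsub>E\<^esub> r \<odot>\<^bsub>E\<^esub> e"
          and xu': "(x', u') \<in> G" "r' \<in> carrier R" "q = x' \<oplus>\<^bsub>B\<^esub> r' \<odot>\<^bsub>B\<^esub> b" "z = u' \<oplus>\<^bsub>E\<^esub> r' \<odot>\<^bsub>E\<^esub> e"
          unfolding G'_def by auto
        have "p \<oplus>\<^bsub>B\<^esub> q = (x \<oplus>\<^bsub>B\<^esub> x') \<oplus>\<^bsub>B\<^esub> (r \<oplus>\<^bsub>R\<^esub> r') \<odot>\<^bsub>B\<^esub> b"
          using xu xu' Gsub[OF xu(1)] Gsub[OF xu'(1)] b by (simp add: B.smult_l_distr B.M.a_ac)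
        moreover have "y \<oplus>\<^bsub>E\<^esub> z = (u \<oplus>\<^bsub>E\<^esub> u') \<oplus>\<^bsub>E\<^esub> (r \<oplus>\<^bsub>R\<^esub> r') \<odot>\<^bsub>E\<^esub> e"
          using xu xu' Gsub[OF xu(1)] Gsub[OF xu'(1)] e by (simp add: E.smult_l_distr E.M.a_ac)
        ultimately show ?thesis
          using G'I[OF Gadd[OF xu(1) xu'(1)], of "r \<oplus>\<^bsub>R\<^esub> r'"] xu(2) xu'(2) by simp
      qed
      show "(s \<odot>\<^bsub>B\<^esub> p, s \<odot>\<^bsub>E\<^esub> y) \<in> G'" if hyp: "s \<in> carrier R \<and> (p, y) \<in> G'" for s p y
      proof -
        from hyp obtain x u r where
          xu: "(x, u) \<in> G" "r \<in> carrier R" "p = x \<oplus>\<^bsub>B\<^esub> r \<odot>\<^bsub>B\<^esub> b" "y = u \<oplus>\<^bsub>E\<^esub> r \<odot>\<^bsub>E\<^esub> e"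
          unfolding G'_def by auto
        have s: "s \<in> carrier R" using hyp by simp
        have "s \<odot>\<^bsub>B\<^esub> p = s \<odot>\<^bsub>B\<^esub> x \<oplus>\<^bsub>B\<^esub> (s \<otimes>\<^bsub>R\<^esub> r) \<odot>\<^bsub>B\<^esub> b"
          using xu s Gsub[OF xu(1)] b by (simp add: B.smult_r_distr B.smult_assoc1)
        moreover have "s \<odot>\<^bsub>E\<^esub> y = s \<odot>\<^bsub>E\<^esub> u \<oplus>\<^bsub>E\<^esub> (s \<otimes>\<^bsub>R\<^esub> r) \<odot>\<^bsub>E\<^esub> e"
          using xu s Gsub[OF xu(1)] e by (simp add: E.smult_r_distr E.smult_assoc1)
        ultimately show ?thesis
          using G'I[OF Gsm[OF s xu(1)], of "s \<otimes>\<^bsub>R\<^esub> r"] xu(2) s by simp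
      qed
      show "y = \<zero>\<^bsub>E\<^esub>" if hyp: "(\<zero>\<^bsub>B\<^esub>, y) \<in> G'" for y
      proof -
        from hyp obtain x u r where
          xu: "(x, u) \<in> G" "r \<in> carrier R" "\<zero>\<^bsub>B\<^esub> = x \<oplus>\<^bsub>B\<^esub> r \<odot>\<^bsub>B\<^esub> b" "y = u \<oplus>\<^bsub>E\<^esub> r \<odot>\<^bsub>E\<^esub> e"
          unfolding G'_def by auto
        note c = Gsub[OF xu(1)]
        have "r \<odot>\<^bsub>B\<^esub> b = \<ominus>\<^bsub>B\<^esub> x"
          using xu c b by (metis B.M.a_comm B.M.minus_equality B.smult_closed)
        then have rG: "(r \<odot>\<^bsub>B\<^esub> b, \<ominus>\<^bsub>E\<^esub> u) \<in> G" using Gneg[OF xu(1)] by simp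
        then have rI: "r \<in> I" using xu unfolding I_def by auto
        have "r \<odot>\<^bsub>E\<^esub> e = \<ominus>\<^bsub>E\<^esub> u"
          using Guniq[OF \<phi>G[OF rI] rG] \<phi>e[OF rI] by simp
        then show ?thesis using xu c by (simp add: E.M.r_neg)
      qed
    qed
    then have "G' = G" using max GG' by blast
    moreover have "(\<zero>\<^bsub>B\<^esub> \<oplus>\<^bsub>B\<^esub> \<one>\<^bsub>R\<^esub> \<odot>\<^bsub>B\<^esub> b, \<zero>\<^bsub>E\<^esub> \<oplus>\<^bsub>E\<^esub> \<one>\<^bsub>R\<^esub> \<odot>\<^bsub>E\<^esub> e) \<in> G'"
      using G'I[OF G00 E.R.one_closed] .
    ultimately show ?thesis using b e by auto
  qed
  define h where "h b = (THE u. (b, u) \<in> G)" for b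
  have h: "(b, h b) \<in> G" if b: "b \<in> carrier B" for b
  proof -
    from dom[OF b] obtain u where u: "(b, u) \<in> G" by auto
    show ?thesis unfolding h_def by (rule theI[of _ u]) (use u Guniq in auto)
  qed
  have "h \<in> mod_hom R B E"
    unfolding mod_hom_def
  proof (intro CollectI conjI ballI funcsetI)
    show "h b \<in> carrier E" if "b \<in> carrier B" for b
      using h[OF that] Gsub by blast
    show "h (x \<oplus>\<^bsub>B\<^esub> y) = h x \<oplus>\<^bsub>E\<^esub> h y" if "x \<in> carrier B" "y \<in> carrier B" for x y
      using that h Gadd Guniq B.M.a_closed by meson
    show "h (r \<odot>\<^bsub>B\<^esub> x) = r \<odot>\<^bsub>E\<^esub> h x" if "r \<in> carrier R" "x \<in> carrier B" for r x
      using that h Gsm Guniq B.smult_closed by meson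
  qed
  moreover have "h (f x) = g x" if "x \<in> carrier A" for x
    using Gf[OF that] h Guniq Gsub by blast
  ultimately show ?thesis by blast
qed

end

theory Submission
  imports Defs
begin

text \<open>
  Let a regular element be one outside all (finitely many) minimal primes; as \<open>R\<close> is reduced, these
  are non-zero-divisors. An injective module is divisible by regular elements, so if it is Hopfian,
  multiplication by a regular element is also injective: the module is a vector space over the
  total quotient ring, a finite product of fields \<open>E(R/P)\<close>. This replaces Matlis' decomposition: a
  maximal independent set of elements annihilated by minimal primes is a basis, and a Hopfian module
  has only finitely many basis elements for each prime, since otherwise a shift of the basis is
  surjective but not injective. Conversely, kernels and images of iterates of an endomorphism
  are subspaces, of which there are only finite chains in a finite-dimensional space. No localization is
  formed: fractions are handled by multiplying with regular elements.
\<close>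

section \<open>Minimal primes of a reduced Noetherian ring\<close>

text \<open>Three devices carry the linear algebra without fractions. For each minimal prime P an
  element a_P, nonzero modulo P and zero modulo all other minimal primes, plays the role of the
  idempotent of the factor at P: the sum of the a_P is regular, and a_P x is killed by P for every
  x. So every x becomes, after multiplication by one regular element, a sum of vectors killed by
  minimal primes; this is why such vectors suffice for a basis. Subspaces appear as submodules
  closed under division by regular elements. Dimension is never counted: the set of pivot positions
  of a subspace takes its place, and having finitely many possible values it must repeat along any
  infinite chain. Of the essential embedding of R/P only the image of 1 is remembered. Hence the
  envelopes can be arbitrary given modules, and each is compared with a vector of E by sending this
  generator to it.\<close>

lemma (in noetherian_ring) ideal_induct [consumes 1, case_names step]:
  assumes "ideal I R"
    and step: "\<And>I. ideal I R \<Longrightarrow> (\<And>J. ideal J R \<Longrightarrow> I \<subset> J \<Longrightarrow> Q J) \<Longrightarrow> Q I"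
  shows "Q I"
proof (rule ccontr)
  assume "\<not> Q I"
  define S where "S = {J. ideal J R \<and> \<not> Q J}"
  have "\<exists>M\<in>S. \<forall>J\<in>S. M \<subseteq> J \<longrightarrow> J = M"
  proof (rule subset_Zorn_nonempty)
    show "S \<noteq> {}" using assms(1) \<open>\<not> Q I\<close> by (auto simp: S_def)
    show "\<Union>C \<in> S" if "C \<noteq> {}" "subset.chain S C" for C
    proof -
      \<comment> \<open>In a Noetherian ring the union of a nonempty chain of ideals is one of its
        members, so it is again a counterexample; Zorn then gives a maximal one.\<close>
      have "subset.chain {I. ideal I R} C"
        using that(2) by (auto simp: S_def subset_chain_def)
      from ideal_chain_is_trivial[OF that(1) this] show ?thesis
        using that(2) by (auto simp: subset_chain_def)
    qed
  qed
  then obtain M where "ideal M R" "\<not> Q M" "\<And>J. ideal J R \<Longrightarrow> M \<subset> J \<Longrightarrow> Q J"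
    unfolding S_def by blast
  with step show False by blast
qed

lemma (in cring) adjoin_ideal:
  assumes I: "ideal I R" and a: "a \<in> carrier R"
  defines "J \<equiv> {i \<oplus> r \<otimes> a | i r. i \<in> I \<and> r \<in> carrier R}"
  shows "ideal J R" "I \<subseteq> J" "a \<in> J"
proof -
  interpret I: ideal I R by fact
  have J: "J = I <+> PIdl a"
    unfolding J_def cgenideal_def set_add_defs by auto
  show "ideal J R"
    unfolding J using I a by (intro add_ideals cgenideal_ideal)
  show "I \<subseteq> J"
  proof
    fix i assume i: "i \<in> I"
    then have "i = i \<oplus> \<zero> \<otimes> a" using a I.Icarr by simp
    with i show "i \<in> J" unfolding J_def by blast
  qed
  have "a = \<zero> \<oplus> \<one> \<otimes> a" using a by simp
  then show "a \<in> J" unfolding J_def using I.zero_closed by blast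
qed

text \<open>Noetherian induction. If I is proper and not prime, take a product a b in I with neither
  factor in I. A prime over I contains I + (a) or I + (b), so the primes obtained for these two
  larger ideals serve together; and since (I + (a))(I + (b)) lies in I, exponents m and n for the
  two ideals give m + n for I.\<close>

lemma (in cring) primes_below_ideal:
  assumes "noetherian_ring R" and "ideal I R"
  shows "\<exists>Ps. finite Ps \<and> (\<forall>P\<in>Ps. primeideal P R) \<and>
    (\<forall>Q. primeideal Q R \<and> I \<subseteq> Q \<longrightarrow> (\<exists>P\<in>Ps. P \<subseteq> Q)) \<and>
    (\<forall>x\<in>carrier R. (\<forall>P\<in>Ps. x \<in> P) \<longrightarrow> (\<exists>n::nat. x [^] n \<in> I))"
    (is "?Q I")
proof (rule noetherian_ring.ideal_induct[OF assms, where Q = ?Q])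
  fix I assume I: "ideal I R" and IH: "\<And>J. ideal J R \<Longrightarrow> I \<subset> J \<Longrightarrow> ?Q J"
  interpret I: ideal I R by fact
  consider "primeideal I R" | "I = carrier R"
    | a b where "a \<in> carrier R" "b \<in> carrier R" "a \<otimes> b \<in> I" "a \<notin> I" "b \<notin> I"
    using primeidealI[OF I is_cring] by blast
  then show "?Q I"
  proof cases
    case 1
    show ?thesis
    proof (intro exI[of _ "{I}"] conjI ballI allI impI)
      show "\<exists>n::nat. x [^] n \<in> I" if "x \<in> carrier R" "\<forall>P\<in>{I}. x \<in> P" for x
        using that by (intro exI[of _ 1]) simp
    qed (use 1 in auto)
  next
    case 2
    show ?thesis
    proof (intro exI[of _ "{}"] conjI ballI allI impI)
      show "\<exists>P\<in>{}. P \<subseteq> Q" if "primeideal Q R \<and> I \<subseteq> Q" for Q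
      proof -
        interpret Q: primeideal Q R using that by blast
        show ?thesis using that 2 Q.I_notcarr Q.a_subset by blast
      qed
    qed (use 2 in auto)
  next
    case (3 a b)
    define J where "J c = {i \<oplus> r \<otimes> c | i r. i \<in> I \<and> r \<in> carrier R}" for c
    have J: "ideal (J c) R" "I \<subseteq> J c" "c \<in> J c" if "c \<in> carrier R" for c
      using adjoin_ideal[OF I that] by (simp_all add: J_def)
    have QJ: "?Q (J c)" if "c \<in> carrier R" "c \<notin> I" for c
      using J[OF that(1)] that(2) by (intro IH) auto
    obtain Pa where Pa: "finite Pa" "\<forall>P\<in>Pa. primeideal P R"
      "\<forall>Q. primeideal Q R \<and> J a \<subseteq> Q \<longrightarrow> (\<exists>P\<in>Pa. P \<subseteq> Q)"
      "\<forall>x\<in>carrier R. (\<forall>P\<in>Pa. x \<in> P) \<longrightarrow> (\<exists>n::nat. x [^] n \<in> J a)"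
      using QJ[OF 3(1) 3(4)] by (elim exE conjE) (rule that)
    obtain Pb where Pb: "finite Pb" "\<forall>P\<in>Pb. primeideal P R"
      "\<forall>Q. primeideal Q R \<and> J b \<subseteq> Q \<longrightarrow> (\<exists>P\<in>Pb. P \<subseteq> Q)"
      "\<forall>x\<in>carrier R. (\<forall>P\<in>Pb. x \<in> P) \<longrightarrow> (\<exists>n::nat. x [^] n \<in> J b)"
      using QJ[OF 3(2) 3(5)] by (elim exE conjE) (rule that)
    have Jsub: "J c \<subseteq> Q" if "primeideal Q R" "I \<subseteq> Q" "c \<in> Q" for c Q
    proof -
      interpret Q: primeideal Q R by fact
      show ?thesis
        using that by (auto simp: J_def intro!: Q.a_closed Q.I_l_closed)
    qed
    \<comment> \<open>Every term of the expanded product has a factor in I except the multiple of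
      \<open>a \<otimes> b\<close>, which is in I by the choice of a and b.\<close>
    have Jmult: "x \<otimes> y \<in> I" if x: "x \<in> J a" and y: "y \<in> J b" for x y
    proof -
      from x obtain i r where x: "i \<in> I" "r \<in> carrier R" "x = i \<oplus> r \<otimes> a"
        unfolding J_def by blast
      from y obtain j s where y: "j \<in> I" "s \<in> carrier R" "y = j \<oplus> s \<otimes> b"
        unfolding J_def by blast
      note c = I.Icarr[OF x(1)] I.Icarr[OF y(1)] 3(1,2) x(2) y(2)
      have "x \<otimes> y = (j \<oplus> s \<otimes> b) \<otimes> i \<oplus> ((r \<otimes> a) \<otimes> j \<oplus> (r \<otimes> s) \<otimes> (a \<otimes> b))"
        unfolding x(3) y(3) using c by (simp add: l_distr r_distr m_ac a_ac)
      also have "\<dots> \<in> I"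
        using c 3(3) x(1) y(1) I.I_l_closed by (intro I.a_closed) simp_all
      finally show ?thesis .
    qed
    show ?thesis
    proof (intro exI[of _ "Pa \<union> Pb"] conjI ballI allI impI)
      show "\<exists>P\<in>Pa \<union> Pb. P \<subseteq> Q" if Q: "primeideal Q R \<and> I \<subseteq> Q" for Q
      proof -
        have "a \<in> Q \<or> b \<in> Q"
          using Q 3 primeideal.I_prime[of Q R a b] by blast
        then show ?thesis
        proof
          assume "a \<in> Q"
          then have "J a \<subseteq> Q" using Jsub Q by simp
          then show ?thesis using Pa(3) Q by (meson UnCI)
        next
          assume "b \<in> Q"
          then have "J b \<subseteq> Q" using Jsub Q by simp
          then show ?thesis using Pb(3) Q by (meson UnCI)
        qed
      qed
      show "\<exists>n::nat. x [^] n \<in> I" if x: "x \<in> carrier R" "\<forall>P\<in>Pa \<union> Pb. x \<in> P" for x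
      proof -
        obtain m n :: nat where "x [^] m \<in> J a" "x [^] n \<in> J b"
          using x Pa(4) Pb(4) by (meson UnCI)
        then have "x [^] (m + n) \<in> I"
          using Jmult x(1) by (metis nat_pow_mult)
        then show ?thesis ..
      qed
    qed (use Pa(1,2) Pb(1,2) in auto)
  qed
qed

locale reduced_noetherian_ring = cring R + noetherian_ring R for R (structure) +
  assumes reduced: "reduced_ring R"
begin

lemma nilpotent_imp_zero: "x \<in> carrier R \<Longrightarrow> x [^] (n::nat) = \<zero> \<Longrightarrow> x = \<zero>"
  using reduced unfolding reduced_ring_def by blast

lemma minimal_prime_is_prime: "P \<in> minimal_primes R \<Longrightarrow> primeideal P R"
  by (simp add: minimal_primes_def)

text \<open>For the zero ideal, the family \<open>Ps\<close> has a member below every prime. A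
  minimal prime equals the member below it, which bounds their number. Conversely the minimal
  members of \<open>Ps\<close> are minimal primes, so an element of all minimal primes lies in all
  of \<open>Ps\<close>; some power of it is then zero, and it vanishes by reducedness.\<close>

lemma
  shows finite_minimal_primes: "finite (minimal_primes R)"
    and minimal_primes_zero: "\<And>x. x \<in> carrier R \<Longrightarrow> (\<And>P. P \<in> minimal_primes R \<Longrightarrow> x \<in> P) \<Longrightarrow> x = \<zero>"
proof -
  obtain Ps where Ps: "finite Ps" "\<forall>P\<in>Ps. primeideal P R"
    "\<forall>Q. primeideal Q R \<and> {\<zero>} \<subseteq> Q \<longrightarrow> (\<exists>P\<in>Ps. P \<subseteq> Q)"
    "\<forall>x\<in>carrier R. (\<forall>P\<in>Ps. x \<in> P) \<longrightarrow> (\<exists>n::nat. x [^] n \<in> {\<zero>})"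
    using primes_below_ideal[OF noetherian_ring_axioms zeroideal] by (elim exE conjE) (rule that)
  have below: "\<exists>P\<in>Ps. P \<subseteq> Q" if "primeideal Q R" for Q
  proof -
    interpret Q: primeideal Q R by fact
    have "{\<zero>} \<subseteq> Q" using Q.zero_closed by simp
    then show ?thesis using Ps(3) that by simp
  qed
  have "minimal_primes R \<subseteq> Ps"
  proof
    fix P assume P: "P \<in> minimal_primes R"
    then obtain P' where "P' \<in> Ps" "P' \<subseteq> P"
      using below minimal_prime_is_prime by meson
    moreover from this have "P' = P"
      using P Ps(2) by (simp add: minimal_primes_def)
    ultimately show "P \<in> Ps" by simp
  qed
  then show "finite (minimal_primes R)"
    using Ps(1) finite_subset by blast
  fix x assume x: "x \<in> carrier R" "\<And>P. P \<in> minimal_primes R \<Longrightarrow> x \<in> P"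
  have "x \<in> Q" if Q: "Q \<in> Ps" for Q
  proof -
    obtain P where P: "P \<in> Ps" "P \<subseteq> Q" "\<forall>P'\<in>Ps. P' \<subseteq> P \<longrightarrow> P = P'"
      using finite_has_minimal2[OF Ps(1) Q] by blast
    have "P \<in> minimal_primes R"
      unfolding minimal_primes_def
    proof (intro CollectI conjI allI impI)
      fix Q' assume Q': "primeideal Q' R \<and> Q' \<subseteq> P"
      then obtain P' where "P' \<in> Ps" "P' \<subseteq> Q'" using below by meson
      with P(3) Q' show "Q' = P" by fastforce
    qed (use P Ps(2) in blast)
    then show ?thesis using x P by blast
  qed
  then obtain n :: nat where "x [^] n = \<zero>" using Ps(4) x(1) by auto
  then show "x = \<zero>" using nilpotent_imp_zero x(1) by blast
qed

section \<open>Regular elements, and substitutes for the idempotents of the total quotient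
  ring\<close>

definition regs :: "'a set" where
  "regs = {s \<in> carrier R. \<forall>P\<in>minimal_primes R. s \<notin> P}"

lemma regsI: "s \<in> carrier R \<Longrightarrow> (\<And>P. P \<in> minimal_primes R \<Longrightarrow> s \<notin> P) \<Longrightarrow> s \<in> regs"
  by (auto simp: regs_def)

lemma regs_closed: "s \<in> regs \<Longrightarrow> s \<in> carrier R"
  and regs_notin: "s \<in> regs \<Longrightarrow> P \<in> minimal_primes R \<Longrightarrow> s \<notin> P"
  by (auto simp: regs_def)

lemma minimal_prime_mult:
  assumes "P \<in> minimal_primes R" "r \<in> carrier R" "s \<in> carrier R"
  shows "r \<otimes> s \<in> P \<longleftrightarrow> r \<in> P \<or> s \<in> P"
proof -
  interpret P: primeideal P R using assms minimal_prime_is_prime by blast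
  show ?thesis using assms P.I_prime P.I_l_closed P.I_r_closed by blast
qed

lemma minimal_prime_one: "P \<in> minimal_primes R \<Longrightarrow> \<one> \<notin> P"
  using primeideal.I_notcarr[OF minimal_prime_is_prime]
    ideal.one_imp_carrier[OF primeideal.axioms(1)[OF minimal_prime_is_prime]] by metis

lemma minimal_prime_closed: "P \<in> minimal_primes R \<Longrightarrow> r \<in> P \<Longrightarrow> r \<in> carrier R"
  using ideal.Icarr[OF primeideal.axioms(1)[OF minimal_prime_is_prime]] .

lemma one_regs: "\<one> \<in> regs"
  by (auto intro: regsI minimal_prime_one dest: minimal_prime_one)

lemma regs_mult: "s \<in> regs \<Longrightarrow> t \<in> regs \<Longrightarrow> s \<otimes> t \<in> regs"
  by (auto simp: regs_def minimal_prime_mult)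

text \<open>Each minimal prime contains s x = 0 but not s, so it contains x; only 0 lies in all of
  them.\<close>

lemma regs_cancel:
  assumes "s \<in> regs" "x \<in> carrier R" "s \<otimes> x = \<zero>"
  shows "x = \<zero>"
proof (rule minimal_primes_zero[OF assms(2)])
  fix P assume P: "P \<in> minimal_primes R"
  interpret P: primeideal P R using P minimal_prime_is_prime by blast
  show "x \<in> P"
    using assms P minimal_prime_mult[of P s x] regs_notin regs_closed P.zero_closed by metis
qed

text \<open>No other minimal prime Q is contained in P, so some element of Q avoids P. The product
  of such elements over the finitely many Q still avoids P, because P is prime.\<close>

lemma isolating_exists:
  assumes P: "P \<in> minimal_primes R"
  shows "\<exists>a\<in>carrier R. a \<notin> P \<and> (\<forall>Q\<in>minimal_primes R. Q \<noteq> P \<longrightarrow> a \<in> Q)"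
proof -
  have "\<exists>a\<in>carrier R. a \<notin> P \<and> (\<forall>Q\<in>A. a \<in> Q)"
    if "finite A" "A \<subseteq> minimal_primes R - {P}" for A
    using that
  proof (induction A)
    case empty
    then show ?case using minimal_prime_one[OF P] by blast
  next
    case (insert Q A)
    then obtain a where a: "a \<in> carrier R" "a \<notin> P" "\<forall>Q\<in>A. a \<in> Q" by blast
    have "\<not> Q \<subseteq> P"
      using insert.prems P unfolding minimal_primes_def by blast
    then obtain q where q: "q \<in> Q" "q \<notin> P" by blast
    have qc: "q \<in> carrier R" using q(1) insert.prems minimal_prime_closed by blast
    show ?case
    proof (intro bexI[of _ "q \<otimes> a"] conjI ballI)
      show "q \<otimes> a \<in> Q'" if "Q' \<in> insert Q A" for Q'
        using that minimal_prime_mult[of Q' q a] insert.prems a q qc by blast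
    qed (use a q qc P minimal_prime_mult in auto)
  qed
  from this[of "minimal_primes R - {P}"] show ?thesis
    using finite_minimal_primes by auto
qed

text \<open>The numerator of an idempotent: dividing \<open>isolating P\<close> by the regular sum
  of all \<open>isolating Q\<close> would give the idempotent of the factor at P in the total
  quotient ring.\<close>

definition isolating :: "'a set \<Rightarrow> 'a" where
  "isolating P = (SOME a. a \<in> carrier R \<and> a \<notin> P \<and> (\<forall>Q\<in>minimal_primes R. Q \<noteq> P \<longrightarrow> a \<in> Q))"

lemma
  assumes "P \<in> minimal_primes R"
  shows isolating_closed: "isolating P \<in> carrier R"
    and isolating_notin: "isolating P \<notin> P"
    and isolating_in: "\<And>Q. Q \<in> minimal_primes R \<Longrightarrow> Q \<noteq> P \<Longrightarrow> isolating P \<in> Q"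
  using someI_ex[OF isolating_exists[OF assms, unfolded Bex_def]]
  unfolding isolating_def by blast+

text \<open>The product lies in P through r and in every other minimal prime through
  \<open>isolating P\<close>.\<close>

lemma isolating_annihilates:
  assumes P: "P \<in> minimal_primes R" and r: "r \<in> P"
  shows "r \<otimes> isolating P = \<zero>"
proof (rule minimal_primes_zero)
  note c = minimal_prime_closed[OF P r] isolating_closed[OF P]
  show "r \<otimes> isolating P \<in> carrier R" using c by simp
  show "r \<otimes> isolating P \<in> Q" if "Q \<in> minimal_primes R" for Q
    using minimal_prime_mult[OF that c] r isolating_in[OF P that] by blast
qed

text \<open>Modulo P a single term survives: each \<open>isolating Q\<close> with Q different from P
  is in P.\<close>

lemma isolating_combination_split:
  assumes P: "P \<in> minimal_primes R"
    and c: "\<And>Q. Q \<in> minimal_primes R \<Longrightarrow> c Q \<in> carrier R"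
  shows "\<exists>p\<in>P. (\<Oplus>Q\<in>minimal_primes R. c Q \<otimes> isolating Q) = c P \<otimes> isolating P \<oplus> p"
proof
  let ?M = "minimal_primes R"
  interpret P: primeideal P R using P minimal_prime_is_prime by blast
  have t: "c Q \<otimes> isolating Q \<in> carrier R" if "Q \<in> ?M" for Q
    using c[OF that] isolating_closed[OF that] by simp
  have M: "?M = insert P (?M - {P})" using P by blast
  show "(\<Oplus>Q\<in>?M. c Q \<otimes> isolating Q) =
      c P \<otimes> isolating P \<oplus> (\<Oplus>Q\<in>?M - {P}. c Q \<otimes> isolating Q)"
    by (subst M, subst finsum_insert) (use t P finite_minimal_primes in auto)
  have "(\<Oplus>Q\<in>A. c Q \<otimes> isolating Q) \<in> P" if "finite A" "A \<subseteq> ?M - {P}" for A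
    using that
  proof (induction A)
    case (insert Q A)
    have "c Q \<otimes> isolating Q \<in> P"
      using insert.prems c isolating_in[of Q P] P by (auto intro!: P.I_l_closed)
    with insert t show ?case
      by (subst finsum_insert) (auto intro!: P.a_closed)
  qed auto
  then show "(\<Oplus>Q\<in>?M - {P}. c Q \<otimes> isolating Q) \<in> P"
    using finite_minimal_primes by blast
qed

text \<open>A substitute for the Chinese remainder theorem: modulo P the combination is
  \<open>c P \<otimes> isolating P\<close>, a product of two elements outside P. Coefficients that
  are nonzero at their own primes are thus glued into one regular element.\<close>

lemma isolating_combination_regs:
  assumes c: "\<And>P. P \<in> minimal_primes R \<Longrightarrow> c P \<in> carrier R - P"
  shows "(\<Oplus>P\<in>minimal_primes R. c P \<otimes> isolating P) \<in> regs" (is "?s \<in> regs")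
proof -
  have t: "c Q \<otimes> isolating Q \<in> carrier R" if "Q \<in> minimal_primes R" for Q
    using c[OF that] isolating_closed[OF that] by simp
  have "?s \<notin> P" if P: "P \<in> minimal_primes R" for P
  proof
    interpret P: primeideal P R using P minimal_prime_is_prime by blast
    assume s: "?s \<in> P"
    obtain p where p: "p \<in> P" "?s = c P \<otimes> isolating P \<oplus> p"
      using isolating_combination_split[OF P, of c] c by blast
    have "c P \<otimes> isolating P = ?s \<oplus> \<ominus> p"
      unfolding p(2) using t[OF P] P.Icarr[OF p(1)] by (simp add: a_assoc r_neg)
    also have "\<dots> \<in> P"
      using s p(1) by (intro P.a_closed P.a_inv_closed)
    finally show False
      using P minimal_prime_mult c isolating_closed isolating_notin by blast
  qed
  then show ?thesis using t by (intro regsI finsum_closed) auto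
qed

text \<open>An element that is only known to be nonzero modulo P may be a zero divisor. On vectors
  killed by P, however, p acts as zero, so there d r acts like a regular element and r can be
  cancelled in torsion-free modules.\<close>

lemma regular_combination:
  assumes P: "P \<in> minimal_primes R" and r: "r \<in> carrier R" "r \<notin> P"
  shows "\<exists>d\<in>carrier R. \<exists>p\<in>P. d \<otimes> r \<oplus> p \<in> regs"
proof -
  \<comment> \<open>Glue r at P with 1 at all other minimal primes. The part at P is
    \<open>isolating P \<otimes> r\<close>, so d is \<open>isolating P\<close>, and the remaining
    terms form p.\<close>
  define c where "c Q = (if Q = P then r else \<one>)" for Q
  have c: "c Q \<in> carrier R - Q" if "Q \<in> minimal_primes R" for Q
    using that r minimal_prime_one by (auto simp: c_def)
  obtain p where p: "p \<in> P"
    "(\<Oplus>Q\<in>minimal_primes R. c Q \<otimes> isolating Q) = c P \<otimes> isolating P \<oplus> p"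
    using isolating_combination_split[OF P, of c] c by blast
  have "isolating P \<otimes> r \<oplus> p = (\<Oplus>Q\<in>minimal_primes R. c Q \<otimes> isolating Q)"
    unfolding p(2) using r isolating_closed[OF P] by (simp add: c_def m_comm)
  also have "\<dots> \<in> regs"
    by (rule isolating_combination_regs) (fact c)
  finally show ?thesis using isolating_closed[OF P] p(1) by blast
qed

end

section \<open>Module homomorphisms\<close>

lemma (in abelian_group) minus_eq_zero_iff:
  assumes "a \<in> carrier G" "b \<in> carrier G"
  shows "a \<ominus> b = \<zero> \<longleftrightarrow> a = b"
  using assms by (metis a_minus_def add.inv_closed minus_equality minus_minus r_neg)

lemma mod_homI:
  assumes "\<And>x. x \<in> carrier M \<Longrightarrow> f x \<in> carrier N"
    and "\<And>x y. x \<in> carrier M \<Longrightarrow> y \<in> carrier M \<Longrightarrow> f (x \<oplus>\<^bsub>M\<^esub> y) = f x \<oplus>\<^bsub>N\<^esub> f y"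
    and "\<And>r x. r \<in> carrier R \<Longrightarrow> x \<in> carrier M \<Longrightarrow> f (r \<odot>\<^bsub>M\<^esub> x) = r \<odot>\<^bsub>N\<^esub> f x"
  shows "f \<in> mod_hom R M N"
  using assms by (auto simp: mod_hom_def)

lemma
  assumes "f \<in> mod_hom R M N"
  shows mod_hom_closed: "\<And>x. x \<in> carrier M \<Longrightarrow> f x \<in> carrier N"
    and mod_hom_add: "\<And>x y. x \<in> carrier M \<Longrightarrow> y \<in> carrier M \<Longrightarrow> f (x \<oplus>\<^bsub>M\<^esub> y) = f x \<oplus>\<^bsub>N\<^esub> f y"
    and mod_hom_smult: "\<And>r x. r \<in> carrier R \<Longrightarrow> x \<in> carrier M \<Longrightarrow> f (r \<odot>\<^bsub>M\<^esub> x) = r \<odot>\<^bsub>N\<^esub> f x"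
  using assms by (auto simp: mod_hom_def)

lemma mod_hom_compose:
  assumes f: "f \<in> mod_hom R L M" and g: "g \<in> mod_hom R M N"
  shows "(\<lambda>x. g (f x)) \<in> mod_hom R L N"
  using mod_hom_closed[OF f] mod_hom_closed[OF g]
  by (intro mod_homI)
    (simp_all add: mod_hom_add[OF f] mod_hom_add[OF g] mod_hom_smult[OF f] mod_hom_smult[OF g])

lemma mod_hom_zero:
  assumes M: "module R M" and N: "module R N" and f: "f \<in> mod_hom R M N"
  shows "f \<zero>\<^bsub>M\<^esub> = \<zero>\<^bsub>N\<^esub>"
proof -
  interpret M: module R M by fact
  interpret N: module R N by fact
  have "f (\<zero>\<^bsub>R\<^esub> \<odot>\<^bsub>M\<^esub> \<zero>\<^bsub>M\<^esub>) = \<zero>\<^bsub>R\<^esub> \<odot>\<^bsub>N\<^esub> f \<zero>\<^bsub>M\<^esub>"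
    by (rule mod_hom_smult[OF f]) auto
  then show ?thesis using mod_hom_closed[OF f, of "\<zero>\<^bsub>M\<^esub>"] by simp
qed

lemma mod_hom_minus:
  assumes M: "module R M" and N: "module R N" and f: "f \<in> mod_hom R M N" and x: "x \<in> carrier M"
  shows "f (\<ominus>\<^bsub>M\<^esub> x) = \<ominus>\<^bsub>N\<^esub> f x"
proof -
  interpret M: module R M by fact
  interpret N: module R N by fact
  have "f ((\<ominus>\<^bsub>R\<^esub> \<one>\<^bsub>R\<^esub>) \<odot>\<^bsub>M\<^esub> x) = (\<ominus>\<^bsub>R\<^esub> \<one>\<^bsub>R\<^esub>) \<odot>\<^bsub>N\<^esub> f x"
    by (rule mod_hom_smult[OF f]) (use x in auto)
  then show ?thesis
    using x mod_hom_closed[OF f x] by (simp add: M.smult_l_minus N.smult_l_minus)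
qed

lemma mod_hom_inj_onI:
  assumes M: "module R M" and N: "module R N" and f: "f \<in> mod_hom R M N"
    and ker: "\<And>x. x \<in> carrier M \<Longrightarrow> f x = \<zero>\<^bsub>N\<^esub> \<Longrightarrow> x = \<zero>\<^bsub>M\<^esub>"
  shows "inj_on f (carrier M)"
proof (rule inj_onI)
  interpret M: module R M by fact
  interpret N: module R N by fact
  fix x y assume xy: "x \<in> carrier M" "y \<in> carrier M" "f x = f y"
  have "f (x \<ominus>\<^bsub>M\<^esub> y) = \<zero>\<^bsub>N\<^esub>"
    using xy mod_hom_closed[OF f]
    by (simp add: a_minus_def mod_hom_add[OF f] mod_hom_minus[OF M N f] N.r_neg)
  then have "x \<ominus>\<^bsub>M\<^esub> y = \<zero>\<^bsub>M\<^esub>" using ker xy by simp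
  then show "x = y" using xy by (simp add: M.M.minus_eq_zero_iff)
qed

lemma mod_iso_inverse:
  assumes M: "module R M" and f: "f \<in> mod_iso R M N"
  shows "inv_into (carrier M) f \<in> mod_iso R N M"
proof -
  interpret M: module R M by fact
  let ?g = "inv_into (carrier M) f"
  have fh: "f \<in> mod_hom R M N" and bij: "bij_betw f (carrier M) (carrier N)"
    using f by (auto simp: mod_iso_def)
  have gf: "?g (f x) = x" if "x \<in> carrier M" for x
    using bij that by (simp add: bij_betw_inv_into_left)
  have fg: "f (?g y) = y" "?g y \<in> carrier M" if "y \<in> carrier N" for y
    using bij that bij_betw_inv_into_right[OF bij that] bij_betw_apply[OF bij_betw_inv_into[OF bij]]
    by auto
  have "?g \<in> mod_hom R N M"
  proof (rule mod_homI)
    fix x y assume xy: "x \<in> carrier N" "y \<in> carrier N"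
    have "?g (f (?g x \<oplus>\<^bsub>M\<^esub> ?g y)) = ?g x \<oplus>\<^bsub>M\<^esub> ?g y"
      using xy fg by (intro gf) simp
    then show "?g (x \<oplus>\<^bsub>N\<^esub> y) = ?g x \<oplus>\<^bsub>M\<^esub> ?g y"
      using xy by (simp add: mod_hom_add[OF fh] fg)
  next
    fix r x assume rx: "r \<in> carrier R" "x \<in> carrier N"
    have "?g (f (r \<odot>\<^bsub>M\<^esub> ?g x)) = r \<odot>\<^bsub>M\<^esub> ?g x"
      using rx fg by (intro gf) simp
    then show "?g (r \<odot>\<^bsub>N\<^esub> x) = r \<odot>\<^bsub>M\<^esub> ?g x"
      using rx by (simp add: mod_hom_smult[OF fh] fg)
  qed (fact fg(2))
  then show ?thesis
    using bij_betw_inv_into[OF bij] by (simp add: mod_iso_def)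
qed

lemma mod_iso_compose:
  assumes f: "f \<in> mod_iso R L M" and g: "g \<in> mod_iso R M N"
  shows "(\<lambda>x. g (f x)) \<in> mod_iso R L N"
  using assms mod_hom_compose[of f R L M g N] bij_betw_trans[of f "carrier L" "carrier M" g "carrier N"]
  by (simp add: mod_iso_def comp_def)

text \<open>Conjugation with f turns surjective endomorphisms of N into surjective endomorphisms of
  M.\<close>

lemma hopfian_iso:
  assumes M: "module R M" and f: "f \<in> mod_iso R M N" and hopf: "hopfian R M"
  shows "hopfian R N"
  unfolding hopfian_def
proof (intro ballI impI)
  fix g assume g: "g \<in> mod_hom R N N" and surj: "g ` carrier N = carrier N"
  let ?h = "inv_into (carrier M) f"
  have h: "?h \<in> mod_iso R N M" by (rule mod_iso_inverse[OF M f])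
  have fim: "f ` carrier M = carrier N" and him: "?h ` carrier N = carrier M"
    using f h by (auto simp: mod_iso_def bij_betw_def)
  have "(\<lambda>x. ?h (g (f x))) \<in> mod_hom R M M"
    using mod_hom_compose[of f R M N, OF _ mod_hom_compose[OF g, of ?h M]] f h
    by (simp add: mod_iso_def)
  moreover have "(\<lambda>x. ?h (g (f x))) ` carrier M = carrier M"
    using fim surj him by (metis image_image)
  ultimately have k: "(\<lambda>x. ?h (g (f x))) \<in> mod_iso R M M"
    using hopf by (auto simp: hopfian_def)
  have "inj_on g (f ` carrier M)"
  proof (rule inj_onI)
    fix x y assume "x \<in> f ` carrier M" "y \<in> f ` carrier M" and g: "g x = g y"
    then obtain a b where ab: "a \<in> carrier M" "b \<in> carrier M" "x = f a" "y = f b" by blast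
    have "inj_on (\<lambda>x. ?h (g (f x))) (carrier M)"
      using k by (simp add: mod_iso_def bij_betw_def)
    from inj_onD[OF this, of a b] show "x = y" using ab g by simp
  qed
  then show "g \<in> mod_iso R N N"
    using g surj fim by (simp add: mod_iso_def bij_betw_def)
qed

definition ring_module :: "('a, 'k) ring_scheme \<Rightarrow> ('a, 'a) module" where
  "ring_module R = \<lparr>carrier = carrier R, monoid.mult = monoid.mult R, one = \<one>\<^bsub>R\<^esub>,
     ring.zero = \<zero>\<^bsub>R\<^esub>, add = add R, smult = monoid.mult R\<rparr>"

lemma (in cring) ring_module_is_module: "module R (ring_module R)"
proof (rule moduleI)
  show "abelian_group (ring_module R)"
    by (rule abelian_groupI)
      (auto simp: ring_module_def a_ac intro: bexI[of _ "\<ominus> _"] l_neg)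
qed (use is_cring in \<open>auto simp: ring_module_def l_distr r_distr m_assoc\<close>)

lemma (in module) smult_minus_distr:
  assumes "r \<in> carrier R" "s \<in> carrier R" "x \<in> carrier M"
  shows "(r \<ominus> s) \<odot>\<^bsub>M\<^esub> x = r \<odot>\<^bsub>M\<^esub> x \<ominus>\<^bsub>M\<^esub> s \<odot>\<^bsub>M\<^esub> x"
  using assms by (simp add: a_minus_def smult_l_distr smult_l_minus)

lemma (in module) smult_comm:
  assumes "r \<in> carrier R" "s \<in> carrier R" "x \<in> carrier M"
  shows "r \<odot>\<^bsub>M\<^esub> (s \<odot>\<^bsub>M\<^esub> x) = s \<odot>\<^bsub>M\<^esub> (r \<odot>\<^bsub>M\<^esub> x)"
  using assms by (simp add: smult_assoc1[symmetric] m_comm)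

lemma (in module) cyclic_submodule:
  assumes x: "x \<in> carrier M"
  shows "submodule {r \<odot>\<^bsub>M\<^esub> x | r. r \<in> carrier R} R M"
proof -
  define N where "N = {r \<odot>\<^bsub>M\<^esub> x | r. r \<in> carrier R}"
  have NI: "r \<odot>\<^bsub>M\<^esub> x \<in> N" if "r \<in> carrier R" for r using that by (auto simp: N_def)
  have "submodule N R M"
  proof (rule submoduleI)
    show "N \<subseteq> carrier M" using x by (auto simp: N_def)
    show "\<zero>\<^bsub>M\<^esub> \<in> N" using NI[OF R.zero_closed] x by simp
    show "\<ominus>\<^bsub>M\<^esub> a \<in> N" if "a \<in> N" for a
      using that NI[OF R.a_inv_closed] x by (auto simp: N_def smult_l_minus[symmetric])
    show "a \<oplus>\<^bsub>M\<^esub> b \<in> N" if "a \<in> N" "b \<in> N" for a b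
      using that NI[OF R.add.m_closed] x by (auto simp: N_def smult_l_distr[symmetric])
    show "r \<odot>\<^bsub>M\<^esub> a \<in> N" if "r \<in> carrier R" "a \<in> N" for r a
      using that NI[OF R.m_closed] x by (auto simp: N_def smult_assoc1[symmetric])
  qed
  then show ?thesis by (simp add: N_def)
qed

lemma (in module) smult_endo: "r \<in> carrier R \<Longrightarrow> (\<lambda>x. r \<odot>\<^bsub>M\<^esub> x) \<in> mod_hom R M M"
  by (rule mod_homI) (auto simp: smult_r_distr smult_comm)

section \<open>Torsion-free divisible modules and envelopes of residue rings\<close>

context reduced_noetherian_ring
begin

definition torsion_free :: "('a, 'm, 'p) module_scheme \<Rightarrow> bool" where
  "torsion_free M \<longleftrightarrow> (\<forall>s\<in>regs. \<forall>x\<in>carrier M. s \<odot>\<^bsub>M\<^esub> x = \<zero>\<^bsub>M\<^esub> \<longrightarrow> x = \<zero>\<^bsub>M\<^esub>)"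

definition divisible :: "('a, 'm, 'p) module_scheme \<Rightarrow> bool" where
  "divisible M \<longleftrightarrow> (\<forall>s\<in>regs. \<forall>x\<in>carrier M. \<exists>y\<in>carrier M. s \<odot>\<^bsub>M\<^esub> y = x)"

lemma torsion_freeD:
  "torsion_free M \<Longrightarrow> s \<in> regs \<Longrightarrow> x \<in> carrier M \<Longrightarrow> s \<odot>\<^bsub>M\<^esub> x = \<zero>\<^bsub>M\<^esub> \<Longrightarrow> x = \<zero>\<^bsub>M\<^esub>"
  by (simp add: torsion_free_def)

lemma divisibleD:
  "divisible M \<Longrightarrow> s \<in> regs \<Longrightarrow> x \<in> carrier M \<Longrightarrow> \<exists>y\<in>carrier M. s \<odot>\<^bsub>M\<^esub> y = x"
  by (simp add: divisible_def)

lemma torsion_free_cancel: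
  assumes M: "module R M" and tf: "torsion_free M"
    and s: "s \<in> regs" and xy: "x \<in> carrier M" "y \<in> carrier M" "s \<odot>\<^bsub>M\<^esub> x = s \<odot>\<^bsub>M\<^esub> y"
  shows "x = y"
proof -
  interpret M: module R M by fact
  have "inj_on (\<lambda>x. s \<odot>\<^bsub>M\<^esub> x) (carrier M)"
    using mod_hom_inj_onI[OF M M M.smult_endo] torsion_freeD[OF tf s] regs_closed[OF s] by blast
  then show ?thesis using xy by (auto dest: inj_onD)
qed

text \<open>Multiplication by s is an injective endomorphism of R as a module over itself. Extending
  r \<mapsto> r x along it gives h with h(s) = x, so h(1) is a quotient of x by s.\<close>

lemma injective_imp_divisible:
  assumes E: "injective_module R E"
  shows "divisible E"
  unfolding divisible_def
proof (intro ballI)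
  fix s x assume s: "s \<in> regs" and x: "x \<in> carrier E"
  interpret E: module R E using E by (simp add: injective_module_def)
  note RR = ring_module_is_module
  have sc: "s \<in> carrier R" using s regs_closed by blast
  have f: "(\<lambda>r. s \<otimes> r) \<in> mod_hom R (ring_module R) (ring_module R)"
    using sc by (intro mod_homI) (auto simp: ring_module_def r_distr m_lcomm)
  moreover have "inj_on (\<lambda>r. s \<otimes> r) (carrier (ring_module R))"
    using mod_hom_inj_onI[OF RR RR f] regs_cancel[OF s] by (auto simp: ring_module_def)
  moreover have "(\<lambda>r. r \<odot>\<^bsub>E\<^esub> x) \<in> mod_hom R (ring_module R) E"
    using x by (intro mod_homI) (auto simp: ring_module_def E.smult_l_distr E.smult_assoc1)
  ultimately obtain h where h: "h \<in> mod_hom R (ring_module R) E"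
      "\<forall>r\<in>carrier (ring_module R). h (s \<otimes> r) = r \<odot>\<^bsub>E\<^esub> x"
    using injective_module_extends[OF E RR RR] by metis
  have one: "\<one> \<in> carrier (ring_module R)" by (simp add: ring_module_def)
  have "h (s \<otimes> \<one>) = x" using h(2) one x by (simp del: r_one)
  moreover have "h (s \<odot>\<^bsub>ring_module R\<^esub> \<one>) = s \<odot>\<^bsub>E\<^esub> h \<one>"
    using sc one by (rule mod_hom_smult[OF h(1)])
  ultimately have "s \<odot>\<^bsub>E\<^esub> h \<one> = x" by (simp add: ring_module_def)
  then show "\<exists>y\<in>carrier E. s \<odot>\<^bsub>E\<^esub> y = x"
    using mod_hom_closed[OF h(1) one] by blast
qed

lemma injective_hopfian_imp_torsion_free:
  assumes E: "injective_module R E" and hopf: "hopfian R E"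
  shows "torsion_free E"
  unfolding torsion_free_def
proof (intro ballI impI)
  fix s x assume s: "s \<in> regs" and x: "x \<in> carrier E" "s \<odot>\<^bsub>E\<^esub> x = \<zero>\<^bsub>E\<^esub>"
  interpret E: module R E using E by (simp add: injective_module_def)
  have sc: "s \<in> carrier R" using s regs_closed by blast
  have "(\<lambda>x. s \<odot>\<^bsub>E\<^esub> x) ` carrier E = carrier E"
    using divisibleD[OF injective_imp_divisible[OF E] s] sc by fastforce
  then have "inj_on (\<lambda>x. s \<odot>\<^bsub>E\<^esub> x) (carrier E)"
    using hopf E.smult_endo[OF sc] by (auto simp: hopfian_def mod_iso_def bij_betw_def)
  then show "x = \<zero>\<^bsub>E\<^esub>"
    using x sc by (auto dest: inj_onD[of _ _ x "\<zero>\<^bsub>E\<^esub>"])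
qed

text \<open>A nonzero vector of the component of M at P; if M is torsion-free and divisible it spans
  a line over the fraction field of R/P. Only one inclusion between P and the annihilator is
  demanded; torsion-freeness supplies the other.\<close>

definition atom :: "'a set \<Rightarrow> ('a, 'm, 'p) module_scheme \<Rightarrow> 'm \<Rightarrow> bool" where
  "atom P M b \<longleftrightarrow> b \<in> carrier M \<and> b \<noteq> \<zero>\<^bsub>M\<^esub> \<and> (\<forall>p\<in>P. p \<odot>\<^bsub>M\<^esub> b = \<zero>\<^bsub>M\<^esub>)"

text \<open>If some r outside P killed b, a regular element d r + p would kill it too, against
  torsion-freeness.\<close>

lemma atom_smult_eq_zero:
  assumes M: "module R M" and tf: "torsion_free M" and P: "P \<in> minimal_primes R"
    and b: "atom P M b" and r: "r \<in> carrier R"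
  shows "r \<odot>\<^bsub>M\<^esub> b = \<zero>\<^bsub>M\<^esub> \<longleftrightarrow> r \<in> P"
proof
  interpret M: module R M by fact
  have bc: "b \<in> carrier M" and b0: "b \<noteq> \<zero>\<^bsub>M\<^esub>" and Pb: "\<And>p. p \<in> P \<Longrightarrow> p \<odot>\<^bsub>M\<^esub> b = \<zero>\<^bsub>M\<^esub>"
    using b by (auto simp: atom_def)
  show "r \<in> P \<Longrightarrow> r \<odot>\<^bsub>M\<^esub> b = \<zero>\<^bsub>M\<^esub>" by (rule Pb)
  assume rb: "r \<odot>\<^bsub>M\<^esub> b = \<zero>\<^bsub>M\<^esub>"
  show "r \<in> P"
  proof (rule ccontr)
    assume "r \<notin> P"
    then obtain d p where d: "d \<in> carrier R" "p \<in> P" "d \<otimes> r \<oplus> p \<in> regs"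
      using regular_combination[OF P r] by blast
    note pc = minimal_prime_closed[OF P d(2)]
    have "(d \<otimes> r \<oplus> p) \<odot>\<^bsub>M\<^esub> b = \<zero>\<^bsub>M\<^esub>"
      using d pc r bc rb Pb[OF d(2)] by (simp add: M.smult_l_distr M.smult_assoc1)
    then show False using torsion_freeD[OF tf d(3) bc] b0 by blast
  qed
qed

text \<open>The image of 1 under an essential embedding of R/P, described by elements: essentiality
  says that each nonzero x has a multiple which is a nonzero multiple of u, and c outside P is what
  makes that multiple nonzero.\<close>

definition essential_generator :: "'a set \<Rightarrow> ('a, 'm, 'p) module_scheme \<Rightarrow> 'm \<Rightarrow> bool" where
  "essential_generator P F u \<longleftrightarrow> u \<in> carrier F \<and>
     (\<forall>r\<in>carrier R. r \<odot>\<^bsub>F\<^esub> u = \<zero>\<^bsub>F\<^esub> \<longleftrightarrow> r \<in> P) \<and>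
     (\<forall>x\<in>carrier F. x \<noteq> \<zero>\<^bsub>F\<^esub> \<longrightarrow> (\<exists>r\<in>carrier R. \<exists>c\<in>carrier R - P. r \<odot>\<^bsub>F\<^esub> x = c \<odot>\<^bsub>F\<^esub> u))"

lemma
  assumes "essential_generator P F u"
  shows essential_generator_closed: "u \<in> carrier F"
    and essential_generator_eq_zero: "\<And>r. r \<in> carrier R \<Longrightarrow> r \<odot>\<^bsub>F\<^esub> u = \<zero>\<^bsub>F\<^esub> \<longleftrightarrow> r \<in> P"
    and essential_generator_multiple:
      "\<And>x. x \<in> carrier F \<Longrightarrow> x \<noteq> \<zero>\<^bsub>F\<^esub> \<Longrightarrow> \<exists>r\<in>carrier R. \<exists>c\<in>carrier R - P. r \<odot>\<^bsub>F\<^esub> x = c \<odot>\<^bsub>F\<^esub> u"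
  using assms by (auto simp: essential_generator_def)

lemma injective_envelope_essential_generator:
  assumes P: "P \<in> minimal_primes R" and F: "injective_envelope R (quot_module R P) F"
  shows "\<exists>u. essential_generator P F u"
proof -
  interpret P: primeideal P R using P minimal_prime_is_prime by blast
  interpret F: module R F
    using F by (simp add: injective_envelope_def injective_module_def)
  interpret Q: module R "quot_module R P"
    by (rule P.quot_module_is_module[OF is_cring])
  obtain j where j: "j \<in> mod_hom R (quot_module R P) F" "inj_on j (carrier (quot_module R P))"
    and ess: "\<And>N. submodule N R F \<Longrightarrow> N \<noteq> {\<zero>\<^bsub>F\<^esub>} \<Longrightarrow> N \<inter> j ` carrier (quot_module R P) \<noteq> {\<zero>\<^bsub>F\<^esub>}"
    using F by (auto simp: injective_envelope_def essential_embedding_def)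
  have coset: "P +> r \<in> carrier (quot_module R P)" if "r \<in> carrier R" for r
    using that by (auto simp: quot_module_def FactRing_def A_RCOSETS_def')
  have carr: "\<exists>r\<in>carrier R. Y = P +> r" if "Y \<in> carrier (quot_module R P)" for Y
    using that by (auto simp: quot_module_def FactRing_def A_RCOSETS_def')
  have smult: "r \<odot>\<^bsub>quot_module R P\<^esub> (P +> s) = P +> (r \<otimes> s)"
    if "r \<in> carrier R" "s \<in> carrier R" for r s
    using that ring_hom_mult[OF P.rcos_ring_hom that] by (simp add: quot_module_def)
  have zero: "\<zero>\<^bsub>quot_module R P\<^esub> = P"
    by (simp add: quot_module_def FactRing_def)
  have coset0: "P +> r = P \<longleftrightarrow> r \<in> P" if "r \<in> carrier R" for r
    using a_rcos_zero[OF P.is_ideal] P.rcos_const_imp_mem that by blast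
  define u where "u = j (P +> \<one>)"
  have u: "u \<in> carrier F"
    unfolding u_def using mod_hom_closed[OF j(1)] coset by simp
  have ju: "j (P +> r) = r \<odot>\<^bsub>F\<^esub> u" if "r \<in> carrier R" for r
    using mod_hom_smult[OF j(1) that coset[OF one_closed]] that by (simp add: smult u_def)
  have j0: "j P = \<zero>\<^bsub>F\<^esub>"
    using mod_hom_zero[OF Q.module_axioms F.module_axioms j(1)] by (simp add: zero)
  have Pc: "P \<in> carrier (quot_module R P)" using Q.M.zero_closed by (simp add: zero)
  have ann: "r \<odot>\<^bsub>F\<^esub> u = \<zero>\<^bsub>F\<^esub> \<longleftrightarrow> r \<in> P" if r: "r \<in> carrier R" for r
    using inj_on_eq_iff[OF j(2) coset[OF r] Pc] coset0[OF r] by (simp add: ju[OF r] j0)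
  have "\<exists>r\<in>carrier R. \<exists>c\<in>carrier R - P. r \<odot>\<^bsub>F\<^esub> x = c \<odot>\<^bsub>F\<^esub> u"
    if x: "x \<in> carrier F" "x \<noteq> \<zero>\<^bsub>F\<^esub>" for x
  proof -
    \<comment> \<open>Essentiality is applied to the cyclic submodule of x. A nonzero element that
      it shares with the image of R/P is a multiple of x and also equals c u, where c is outside P
      because the element is nonzero.\<close>
    define N where "N = {r \<odot>\<^bsub>F\<^esub> x | r. r \<in> carrier R}"
    have NI: "r \<odot>\<^bsub>F\<^esub> x \<in> N" if "r \<in> carrier R" for r using that by (auto simp: N_def)
    have "submodule N R F" unfolding N_def by (rule F.cyclic_submodule[OF x(1)])
    moreover have "x \<in> N" using NI[OF one_closed] x by simp
    ultimately have "N \<inter> j ` carrier (quot_module R P) \<noteq> {\<zero>\<^bsub>F\<^esub>}"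
      using ess[of N] x by blast
    moreover have "\<zero>\<^bsub>F\<^esub> \<in> N \<inter> j ` carrier (quot_module R P)"
      using NI[OF zero_closed] x j0 Pc by (auto intro: image_eqI[of _ _ P])
    ultimately obtain y where y: "y \<in> N" "y \<in> j ` carrier (quot_module R P)" "y \<noteq> \<zero>\<^bsub>F\<^esub>"
      by blast
    obtain r where r: "r \<in> carrier R" "y = r \<odot>\<^bsub>F\<^esub> x" using y(1) by (auto simp: N_def)
    obtain c where c: "c \<in> carrier R" "y = c \<odot>\<^bsub>F\<^esub> u" using y(2) carr ju by blast
    have "c \<notin> P" using c y(3) ann by blast
    with r c show ?thesis by (metis DiffI)
  qed
  then show ?thesis using u ann unfolding essential_generator_def by blast
qed

section \<open>The envelope of R/P as a line over the fraction field of R/P\<close>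

context
  fixes P :: "'a set" and F :: "('a, 'e, 'q) module_scheme" and u :: 'e
  assumes P: "P \<in> minimal_primes R" and F: "module R F" and u: "essential_generator P F u"
begin

interpretation F: module R F by (fact F)

text \<open>If p x were nonzero, some multiple r p x would be c u with c outside P. Multiplication
  by \<open>isolating P\<close> kills the left side, since its product with p is 0, but not the
  right side, since P is prime.\<close>

lemma generator_annihilates:
  assumes p: "p \<in> P" and x: "x \<in> carrier F"
  shows "p \<odot>\<^bsub>F\<^esub> x = \<zero>\<^bsub>F\<^esub>"
proof (rule ccontr)
  note pc = minimal_prime_closed[OF P p]
  let ?a = "isolating P"
  have a: "?a \<in> carrier R" using isolating_closed[OF P] .
  assume "p \<odot>\<^bsub>F\<^esub> x \<noteq> \<zero>\<^bsub>F\<^esub>"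
  then obtain r c where rc: "r \<in> carrier R" "c \<in> carrier R" "c \<notin> P" "r \<odot>\<^bsub>F\<^esub> (p \<odot>\<^bsub>F\<^esub> x) = c \<odot>\<^bsub>F\<^esub> u"
    using essential_generator_multiple[OF u, of "p \<odot>\<^bsub>F\<^esub> x"] pc x by auto
  have "(?a \<otimes> c) \<odot>\<^bsub>F\<^esub> u = (r \<otimes> (p \<otimes> ?a)) \<odot>\<^bsub>F\<^esub> x"
    using a rc pc x essential_generator_closed[OF u]
    by (simp add: F.smult_assoc1 rc(4)[symmetric]) (metis F.smult_comm F.smult_closed)
  also have "\<dots> = \<zero>\<^bsub>F\<^esub>"
    using isolating_annihilates[OF P p] rc(1) x by simp
  finally have "?a \<otimes> c \<in> P"
    using essential_generator_eq_zero[OF u] a rc by simp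
  then show False
    using minimal_prime_mult[OF P a rc(2)] isolating_notin[OF P] rc(3) by blast
qed

text \<open>A nonzero x has a multiple s x = c u with c outside P. Then r x = 0 gives (r c) u = 0,
  although r c is outside P.\<close>

lemma generator_smult_eq_zero:
  assumes r: "r \<in> carrier R" "r \<notin> P" and x: "x \<in> carrier F" "r \<odot>\<^bsub>F\<^esub> x = \<zero>\<^bsub>F\<^esub>"
  shows "x = \<zero>\<^bsub>F\<^esub>"
proof (rule ccontr)
  assume "x \<noteq> \<zero>\<^bsub>F\<^esub>"
  then obtain s c where c: "s \<in> carrier R" "c \<in> carrier R" "c \<notin> P" "s \<odot>\<^bsub>F\<^esub> x = c \<odot>\<^bsub>F\<^esub> u"
    using essential_generator_multiple[OF u x(1)] by auto
  have "(r \<otimes> c) \<odot>\<^bsub>F\<^esub> u = s \<odot>\<^bsub>F\<^esub> (r \<odot>\<^bsub>F\<^esub> x)"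
    using c r x(1) essential_generator_closed[OF u]
    by (simp add: F.smult_assoc1 c(4)[symmetric] F.smult_comm)
  also have "\<dots> = \<zero>\<^bsub>F\<^esub>" using c x by simp
  finally have "r \<otimes> c \<in> P"
    using essential_generator_eq_zero[OF u] c r by simp
  then show False using minimal_prime_mult[OF P r(1) c(2)] r c by blast
qed

lemma generator_torsion_free: "torsion_free F"
  unfolding torsion_free_def
  using generator_smult_eq_zero regs_closed regs_notin[OF _ P] by blast

text \<open>With r x = c u and r' y = c' u, both (c r') y and (c' r) x equal (c c') u. As c r' is
  outside P, some d (c r') + p is regular, and p kills y.\<close>

lemma generator_one_dimensional:
  assumes x: "x \<in> carrier F" "x \<noteq> \<zero>\<^bsub>F\<^esub>" and y: "y \<in> carrier F"
  shows "\<exists>s\<in>regs. \<exists>r\<in>carrier R. s \<odot>\<^bsub>F\<^esub> y = r \<odot>\<^bsub>F\<^esub> x"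
proof (cases "y = \<zero>\<^bsub>F\<^esub>")
  case True
  then have "\<one> \<odot>\<^bsub>F\<^esub> y = \<zero> \<odot>\<^bsub>F\<^esub> x" using x by simp
  then show ?thesis using one_regs zero_closed by blast
next
  case False
  note uc = essential_generator_closed[OF u]
  obtain r c where rc: "r \<in> carrier R" "c \<in> carrier R" "c \<notin> P" "r \<odot>\<^bsub>F\<^esub> x = c \<odot>\<^bsub>F\<^esub> u"
    using essential_generator_multiple[OF u x] by auto
  obtain r' c' where rc': "r' \<in> carrier R" "c' \<in> carrier R" "c' \<notin> P" "r' \<odot>\<^bsub>F\<^esub> y = c' \<odot>\<^bsub>F\<^esub> u"
    using essential_generator_multiple[OF u y False] by auto
  have "r' \<notin> P"
    using generator_annihilates[OF _ y] rc' essential_generator_eq_zero[OF u] by metis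
  then have "c \<otimes> r' \<notin> P" using minimal_prime_mult[OF P] rc rc' by blast
  then obtain d p where d: "d \<in> carrier R" "p \<in> P" "d \<otimes> (c \<otimes> r') \<oplus> p \<in> regs"
    using regular_combination[OF P, of "c \<otimes> r'"] rc rc' by auto
  have "(d \<otimes> (c \<otimes> r') \<oplus> p) \<odot>\<^bsub>F\<^esub> y = d \<odot>\<^bsub>F\<^esub> (c \<odot>\<^bsub>F\<^esub> (r' \<odot>\<^bsub>F\<^esub> y))"
    using d rc rc' y uc minimal_prime_closed[OF P d(2)] generator_annihilates[OF d(2) y]
    by (simp add: F.smult_l_distr F.smult_assoc1)
  also have "\<dots> = d \<odot>\<^bsub>F\<^esub> (c' \<odot>\<^bsub>F\<^esub> (r \<odot>\<^bsub>F\<^esub> x))"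
    unfolding rc(4) rc'(4) using rc rc' uc by (simp add: F.smult_comm)
  also have "\<dots> = (d \<otimes> (c' \<otimes> r)) \<odot>\<^bsub>F\<^esub> x"
    using d rc rc' x by (simp add: F.smult_assoc1)
  finally show ?thesis using d rc rc' by blast
qed

text \<open>Both u and b have annihilator exactly P, so r u \<mapsto> r b is well defined on the
  cyclic submodule of u and extends to F because E is injective. The extension is injective by
  essentiality: a nonzero kernel element would have a multiple c u with c outside P, and then c b =
  0.\<close>

lemma generator_embeds:
  assumes E: "injective_module R E" and tf: "torsion_free E" and b: "atom P E b"
  shows "\<exists>\<psi>\<in>mod_hom R F E. inj_on \<psi> (carrier F) \<and> \<psi> u = b"
proof -
  interpret E: module R E using E by (simp add: injective_module_def)
  note uc = essential_generator_closed[OF u]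
  note ann_u = essential_generator_eq_zero[OF u]
  note ann_b = atom_smult_eq_zero[OF E.module_axioms tf P b]
  have bc: "b \<in> carrier E" using b by (simp add: atom_def)
  define N where "N = {r \<odot>\<^bsub>F\<^esub> u | r. r \<in> carrier R}"
  have NI: "r \<odot>\<^bsub>F\<^esub> u \<in> N" if "r \<in> carrier R" for r using that by (auto simp: N_def)
  have N: "submodule N R F" unfolding N_def by (rule F.cyclic_submodule[OF uc])
  \<comment> \<open>\<open>SOME\<close> picks one coefficient; any two coefficients of the same y
    differ by an element of P, which kills b.\<close>
  define g where "g y = (SOME r. r \<in> carrier R \<and> y = r \<odot>\<^bsub>F\<^esub> u) \<odot>\<^bsub>E\<^esub> b" for y
  have g: "g (r \<odot>\<^bsub>F\<^esub> u) = r \<odot>\<^bsub>E\<^esub> b" if r: "r \<in> carrier R" for r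
  proof -
    define r' where "r' = (SOME r'. r' \<in> carrier R \<and> r \<odot>\<^bsub>F\<^esub> u = r' \<odot>\<^bsub>F\<^esub> u)"
    have r': "r' \<in> carrier R" "r \<odot>\<^bsub>F\<^esub> u = r' \<odot>\<^bsub>F\<^esub> u"
      unfolding r'_def by (rule someI2[of _ r]; use r in simp)+
    have "(r' \<ominus> r) \<odot>\<^bsub>F\<^esub> u = \<zero>\<^bsub>F\<^esub>"
      using r r' uc by (simp add: F.smult_minus_distr F.M.minus_eq_zero_iff)
    then have "(r' \<ominus> r) \<odot>\<^bsub>E\<^esub> b = \<zero>\<^bsub>E\<^esub>" using ann_u ann_b r r' by simp
    then have "r' \<odot>\<^bsub>E\<^esub> b = r \<odot>\<^bsub>E\<^esub> b"
      using r r' bc by (simp add: E.smult_minus_distr E.M.minus_eq_zero_iff)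
    then show ?thesis by (simp add: g_def r'_def)
  qed
  have "g \<in> mod_hom R (F\<lparr>carrier := N\<rparr>) E"
  proof (rule mod_homI)
    fix x assume x: "x \<in> carrier (F\<lparr>carrier := N\<rparr>)"
    then obtain s where s: "s \<in> carrier R" "x = s \<odot>\<^bsub>F\<^esub> u" by (auto simp: N_def)
    then show "g x \<in> carrier E" using g bc by simp
    show "g (r \<odot>\<^bsub>F\<lparr>carrier := N\<rparr>\<^esub> x) = r \<odot>\<^bsub>E\<^esub> g x" if r: "r \<in> carrier R" for r
      using r s g[of s] g[of "r \<otimes> s"] uc bc by (simp add: F.smult_assoc1 E.smult_assoc1)
    fix y assume "y \<in> carrier (F\<lparr>carrier := N\<rparr>)"
    then obtain t where t: "t \<in> carrier R" "y = t \<odot>\<^bsub>F\<^esub> u" by (auto simp: N_def)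
    show "g (x \<oplus>\<^bsub>F\<lparr>carrier := N\<rparr>\<^esub> y) = g x \<oplus>\<^bsub>E\<^esub> g y"
      using t s g[of s] g[of t] g[of "s \<oplus> t"] uc bc by (simp add: F.smult_l_distr E.smult_l_distr)
  qed
  moreover have "(\<lambda>x. x) \<in> mod_hom R (F\<lparr>carrier := N\<rparr>) F"
    using F.submoduleE(1)[OF N] by (auto simp: mod_hom_def)
  moreover have "module R (F\<lparr>carrier := N\<rparr>)"
    using submodule.submodule_is_module[OF N F] .
  ultimately obtain \<psi> where \<psi>: "\<psi> \<in> mod_hom R F E" "\<forall>x\<in>carrier (F\<lparr>carrier := N\<rparr>). \<psi> x = g x"
    using injective_module_extends[OF E _ F] inj_on_id2 by metis
  have "u \<in> N" using NI[OF one_closed] uc by simp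
  then have \<psi>u: "\<psi> u = b" using \<psi>(2) g[OF one_closed] uc bc by simp
  have "inj_on \<psi> (carrier F)"
  proof (rule mod_hom_inj_onI[OF F E.module_axioms \<psi>(1)], rule ccontr)
    fix x assume x: "x \<in> carrier F" "\<psi> x = \<zero>\<^bsub>E\<^esub>" "x \<noteq> \<zero>\<^bsub>F\<^esub>"
    then obtain r c where rc: "r \<in> carrier R" "c \<in> carrier R" "c \<notin> P" "r \<odot>\<^bsub>F\<^esub> x = c \<odot>\<^bsub>F\<^esub> u"
      using essential_generator_multiple[OF u] by blast
    have "c \<odot>\<^bsub>E\<^esub> b = \<psi> (c \<odot>\<^bsub>F\<^esub> u)"
      using rc \<psi>u uc by (simp add: mod_hom_smult[OF \<psi>(1)])
    also have "\<dots> = \<zero>\<^bsub>E\<^esub>"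
      using rc x by (simp add: rc(4)[symmetric] mod_hom_smult[OF \<psi>(1)])
    finally show False using ann_b rc by blast
  qed
  with \<psi>(1) \<psi>u show ?thesis by blast
qed

end

end

section \<open>Direct sums\<close>

lemma direct_sum_projection:
  "i \<in> I \<Longrightarrow> (\<lambda>x. x i) \<in> mod_hom R (module_direct_sum I M) (M i)"
  by (auto simp: mod_hom_def module_direct_sum_def)

lemma direct_sum_eqI:
  "x \<in> carrier (module_direct_sum I M) \<Longrightarrow> y \<in> carrier (module_direct_sum I M) \<Longrightarrow>
    (\<And>i. i \<in> I \<Longrightarrow> x i = y i) \<Longrightarrow> x = y"
  by (auto simp: module_direct_sum_def intro: PiE_ext)

lemma direct_sum_zero: "i \<in> I \<Longrightarrow> \<zero>\<^bsub>module_direct_sum I M\<^esub> i = \<zero>\<^bsub>M i\<^esub>"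
  by (simp add: module_direct_sum_def)

section \<open>Modules with finitely many one-dimensional coordinates\<close>

lemma funpow_mod_hom:
  assumes "f \<in> mod_hom R M M"
  shows "f ^^ n \<in> mod_hom R M M"
proof (induction n)
  case 0
  then show ?case by (simp add: mod_hom_def)
next
  case (Suc n)
  from mod_hom_compose[OF this assms] show ?case by (simp add: comp_def)
qed

context reduced_noetherian_ring
begin

text \<open>In a torsion-free divisible module these are exactly the subspaces over the total
  quotient ring: quotients by regular elements exist and are unique there, and N is closed under
  taking them.\<close>

definition saturated :: "('a, 'm, 'p) module_scheme \<Rightarrow> 'm set \<Rightarrow> bool" where
  "saturated M N \<longleftrightarrow> submodule N R M \<and> (\<forall>s\<in>regs. \<forall>x\<in>carrier M. s \<odot>\<^bsub>M\<^esub> x \<in> N \<longrightarrow> x \<in> N)"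

lemma saturatedD:
  "saturated M N \<Longrightarrow> s \<in> regs \<Longrightarrow> x \<in> carrier M \<Longrightarrow> s \<odot>\<^bsub>M\<^esub> x \<in> N \<Longrightarrow> x \<in> N"
  by (simp add: saturated_def)

lemma saturated_kernel:
  assumes M: "module R M" and N: "module R N" and tf: "torsion_free N" and f: "f \<in> mod_hom R M N"
  shows "saturated M {x \<in> carrier M. f x = \<zero>\<^bsub>N\<^esub>}"
proof -
  interpret M: module R M by fact
  interpret N: module R N by fact
  have "submodule {x \<in> carrier M. f x = \<zero>\<^bsub>N\<^esub>} R M"
    by (rule M.submoduleI)
      (auto simp: mod_hom_zero[OF M N f] mod_hom_minus[OF M N f] mod_hom_add[OF f] mod_hom_smult[OF f])
  then show ?thesis
    using mod_hom_smult[OF f] mod_hom_closed[OF f] torsion_freeD[OF tf] regs_closed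
    by (auto simp: saturated_def)
qed

text \<open>If s x = f y, divide y in M, say s z = y; then s x = s (f z), and s cancels in
  N.\<close>

lemma saturated_image:
  assumes M: "module R M" and N: "module R N" and dv: "divisible M" and tf: "torsion_free N"
    and f: "f \<in> mod_hom R M N"
  shows "saturated N (f ` carrier M)"
proof -
  interpret M: module R M by fact
  interpret N: module R N by fact
  have "submodule (f ` carrier M) R N"
  proof (rule N.submoduleI)
    show "\<zero>\<^bsub>N\<^esub> \<in> f ` carrier M"
      using mod_hom_zero[OF M N f] by (auto intro: image_eqI[of _ _ "\<zero>\<^bsub>M\<^esub>"])
    show "\<ominus>\<^bsub>N\<^esub> a \<in> f ` carrier M" if "a \<in> f ` carrier M" for a
      using that mod_hom_minus[OF M N f] by (auto intro!: image_eqI[of _ _ "\<ominus>\<^bsub>M\<^esub> _"])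
    show "a \<oplus>\<^bsub>N\<^esub> b \<in> f ` carrier M" if "a \<in> f ` carrier M" "b \<in> f ` carrier M" for a b
    proof -
      from that obtain x y where "x \<in> carrier M" "a = f x" "y \<in> carrier M" "b = f y" by blast
      then show ?thesis using mod_hom_add[OF f] by (intro image_eqI[of _ _ "x \<oplus>\<^bsub>M\<^esub> y"]) auto
    qed
    show "r \<odot>\<^bsub>N\<^esub> a \<in> f ` carrier M" if "r \<in> carrier R" "a \<in> f ` carrier M" for r a
      using that mod_hom_smult[OF f] by (auto intro!: image_eqI[of _ _ "r \<odot>\<^bsub>M\<^esub> _"])
  qed (use mod_hom_closed[OF f] in auto)
  moreover have "x \<in> f ` carrier M"
    if s: "s \<in> regs" and x: "x \<in> carrier N" "s \<odot>\<^bsub>N\<^esub> x \<in> f ` carrier M" for s x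
  proof -
    obtain y where y: "y \<in> carrier M" "s \<odot>\<^bsub>N\<^esub> x = f y" using x by blast
    obtain z where z: "z \<in> carrier M" "s \<odot>\<^bsub>M\<^esub> z = y" using divisibleD[OF dv s y(1)] by blast
    have "s \<odot>\<^bsub>N\<^esub> x = s \<odot>\<^bsub>N\<^esub> f z"
      using y z mod_hom_smult[OF f regs_closed[OF s]] by auto
    then have "x = f z"
      using torsion_free_cancel[OF N tf s x(1)] mod_hom_closed[OF f z(1)] by blast
    then show ?thesis using z by blast
  qed
  ultimately show ?thesis by (auto simp: saturated_def)
qed

text \<open>Leading means highest: k is a pivot if it is the largest index of a nonzero coordinate
  of some x in N.\<close>

definition pivots :: "nat \<Rightarrow> (nat \<Rightarrow> ('a, 'e, 'q) module_scheme) \<Rightarrow> (nat \<Rightarrow> 'm \<Rightarrow> 'e) \<Rightarrow> 'm set \<Rightarrow> nat set"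
  where "pivots m F \<pi> N =
    {k. k < m \<and> (\<exists>x\<in>N. \<pi> k x \<noteq> \<zero>\<^bsub>F k\<^esub> \<and> (\<forall>j. k < j \<and> j < m \<longrightarrow> \<pi> j x = \<zero>\<^bsub>F j\<^esub>))}"

text \<open>The assumptions say, without naming a field, that M embeds through \<pi> into a product
  of m lines \<open>F k\<close>, possibly over different fields.\<close>

context
  fixes M :: "('a, 'm, 'p) module_scheme" and m :: nat
    and F :: "nat \<Rightarrow> ('a, 'e, 'q) module_scheme" and \<pi> :: "nat \<Rightarrow> 'm \<Rightarrow> 'e"
  assumes M: "module R M"
    and F: "\<And>k. k < m \<Longrightarrow> module R (F k)" and tfF: "\<And>k. k < m \<Longrightarrow> torsion_free (F k)"
    and one_dim: "\<And>k x y. k < m \<Longrightarrow> x \<in> carrier (F k) \<Longrightarrow> x \<noteq> \<zero>\<^bsub>F k\<^esub> \<Longrightarrow> y \<in> carrier (F k) \<Longrightarrow>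
      \<exists>s\<in>regs. \<exists>r\<in>carrier R. s \<odot>\<^bsub>F k\<^esub> y = r \<odot>\<^bsub>F k\<^esub> x"
    and \<pi>: "\<And>k. k < m \<Longrightarrow> \<pi> k \<in> mod_hom R M (F k)"
    and separating: "\<And>x. x \<in> carrier M \<Longrightarrow> (\<And>k. k < m \<Longrightarrow> \<pi> k x = \<zero>\<^bsub>F k\<^esub>) \<Longrightarrow> x = \<zero>\<^bsub>M\<^esub>"
begin

interpretation M: module R M by (fact M)

lemma coordinates_torsion_free: "torsion_free M"
  unfolding torsion_free_def
proof (intro ballI impI)
  fix s x assume s: "s \<in> regs" and x: "x \<in> carrier M" "s \<odot>\<^bsub>M\<^esub> x = \<zero>\<^bsub>M\<^esub>"
  show "x = \<zero>\<^bsub>M\<^esub>"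
  proof (rule separating[OF x(1)])
    fix k assume k: "k < m"
    have "s \<odot>\<^bsub>F k\<^esub> \<pi> k x = \<zero>\<^bsub>F k\<^esub>"
      using mod_hom_smult[OF \<pi>[OF k] regs_closed[OF s] x(1)] x(2) mod_hom_zero[OF M F[OF k] \<pi>[OF k]]
      by simp
    then show "\<pi> k x = \<zero>\<^bsub>F k\<^esub>"
      using torsion_freeD[OF tfF[OF k] s] mod_hom_closed[OF \<pi>[OF k] x(1)] by blast
  qed
qed

text \<open>A saturated submodule is a subspace over the total quotient ring; its pivots are the
  positions of the leading entries of its echelon form.\<close>

lemma saturated_eq_if_pivots_eq:
  assumes N: "saturated M N" and N': "saturated M N'" and sub: "N \<subseteq> N'"
    and piv: "pivots m F \<pi> N = pivots m F \<pi> N'"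
  shows "N = N'"
proof -
  have sN: "submodule N R M" and sN': "submodule N' R M" using N N' by (auto simp: saturated_def)
  note SN = M.submoduleE[OF sN] and SN' = M.submoduleE[OF sN']
  have zN: "\<zero>\<^bsub>M\<^esub> \<in> N" using subgroup.one_closed[OF submodule.axioms(1)[OF sN]] by simp
  \<comment> \<open>Induction on a bound k such that all coordinates from k on vanish. For k = m the
    condition is empty, so every element of N' is reached.\<close>
  have "x \<in> N" if "x \<in> N'" "k \<le> m" "\<And>j. k \<le> j \<Longrightarrow> j < m \<Longrightarrow> \<pi> j x = \<zero>\<^bsub>F j\<^esub>" for x k
    using that
  proof (induction k arbitrary: x)
    case 0
    then have "x = \<zero>\<^bsub>M\<^esub>" using SN'(1) by (intro separating) auto
    then show ?case using zN by simp
  next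
    case (Suc k)
    have k: "k < m" using Suc.prems by simp
    interpret Fk: module R "F k" by (rule F[OF k])
    have xM: "x \<in> carrier M" using Suc.prems SN'(1) by blast
    show ?case
    proof (cases "\<pi> k x = \<zero>\<^bsub>F k\<^esub>")
      case True
      then show ?thesis
        using Suc.prems by (intro Suc.IH) (auto simp: less_eq_Suc_le dest: le_neq_implies_less)
    next
      case False
      then have "k \<in> pivots m F \<pi> N'" using Suc.prems k by (auto simp: pivots_def)
      then have "k \<in> pivots m F \<pi> N" by (simp add: piv)
      then obtain y where y: "y \<in> N" "\<pi> k y \<noteq> \<zero>\<^bsub>F k\<^esub>" "\<And>j. k < j \<Longrightarrow> j < m \<Longrightarrow> \<pi> j y = \<zero>\<^bsub>F j\<^esub>"
        unfolding pivots_def by blast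
      have yM: "y \<in> carrier M" using y SN(1) by blast
      obtain s r where sr: "s \<in> regs" "r \<in> carrier R" "s \<odot>\<^bsub>F k\<^esub> \<pi> k x = r \<odot>\<^bsub>F k\<^esub> \<pi> k y"
        using one_dim[OF k mod_hom_closed[OF \<pi>[OF k] yM] y(2) mod_hom_closed[OF \<pi>[OF k] xM]] by blast
      have sc: "s \<in> carrier R" using sr regs_closed by blast
      \<comment> \<open>Gaussian elimination with a denominator: s x - r y has coordinate k equal to
        zero, and its higher coordinates stay zero because x and y both vanish there.\<close>
      let ?z = "s \<odot>\<^bsub>M\<^esub> x \<oplus>\<^bsub>M\<^esub> \<ominus>\<^bsub>M\<^esub> (r \<odot>\<^bsub>M\<^esub> y)"
      have ry: "r \<odot>\<^bsub>M\<^esub> y \<in> N" using SN(4) sr y by blast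
      have \<pi>z: "\<pi> j ?z = s \<odot>\<^bsub>F j\<^esub> \<pi> j x \<oplus>\<^bsub>F j\<^esub> \<ominus>\<^bsub>F j\<^esub> (r \<odot>\<^bsub>F j\<^esub> \<pi> j y)" if "j < m" for j
        using that xM yM sc sr(2)
        by (simp add: mod_hom_add[OF \<pi>] mod_hom_minus[OF M F \<pi>] mod_hom_smult[OF \<pi>])
      have "?z \<in> N"
      proof (rule Suc.IH)
        show "?z \<in> N'" 
          by (rule SN'(5)[OF SN'(4)[OF sc Suc.prems(1)] SN'(3)[OF subsetD[OF sub ry]]])
        show "\<pi> j ?z = \<zero>\<^bsub>F j\<^esub>" if j: "k \<le> j" "j < m" for j
        proof (cases "j = k")
          case True
          then show ?thesis
            using \<pi>z[OF k] sr mod_hom_closed[OF \<pi>[OF k] yM] by (simp add: Fk.M.r_neg)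
        next
          case False
          interpret Fj: module R "F j" by (rule F[OF j(2)])
          show ?thesis using \<pi>z[OF j(2)] Suc.prems(3)[of j] y(3)[of j] j False sc sr(2) by simp
        qed
      qed (use k in simp)
      \<comment> \<open>Adding r y back puts only s x into N; saturation removes the factor
        s.\<close>
      then have "?z \<oplus>\<^bsub>M\<^esub> r \<odot>\<^bsub>M\<^esub> y \<in> N" using SN(5) ry by blast
      moreover have "?z \<oplus>\<^bsub>M\<^esub> r \<odot>\<^bsub>M\<^esub> y = s \<odot>\<^bsub>M\<^esub> x"
        using sc sr xM yM by (simp add: M.a_assoc M.M.l_neg)
      ultimately show ?thesis using saturatedD[OF N sr(1) xM] by simp
    qed
  qed
  from this[of _ m] show ?thesis using sub by force
qed

text \<open>Pigeonhole on the subsets of the m positions. Along a monotone chain of saturated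
  submodules such a repetition forces two stages to coincide.\<close>

lemma pivots_repeat:
  obtains i j where "i < j" "pivots m F \<pi> (N i) = pivots m F \<pi> (N (j::nat))"
proof -
  have "range (\<lambda>n. pivots m F \<pi> (N n)) \<subseteq> Pow {..<m}" by (auto simp: pivots_def)
  then have "\<not> inj (\<lambda>n. pivots m F \<pi> (N n))"
    using finite_subset[OF _ finite_Pow_iff[THEN iffD2, OF finite_lessThan]] range_inj_infinite by blast
  then obtain i j where "i \<noteq> j" "pivots m F \<pi> (N i) = pivots m F \<pi> (N j)" by (auto simp: inj_def)
  then show thesis using that by (cases i j rule: linorder_cases) auto
qed

text \<open>Fitting's argument. Kernels of the iterates of f increase and images decrease; two
  stages with equal pivots coincide, so the chain is stationary between stages i and i + 1.
  Divisibility of M makes the images saturated.\<close>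

lemma coordinates_bi_hopfian:
  assumes dv: "divisible M"
  shows "bi_hopfian R M"
proof -
  note tf = coordinates_torsion_free
  have "inj_on f (carrier M)" if f: "f \<in> mod_hom R M M" and surj: "f ` carrier M = carrier M" for f
  proof (rule mod_hom_inj_onI[OF M M f])
    note fn = funpow_mod_hom[OF f]
    define N where "N n = {x \<in> carrier M. (f ^^ n) x = \<zero>\<^bsub>M\<^esub>}" for n
    have sat: "saturated M (N n)" for n
      unfolding N_def by (rule saturated_kernel[OF M M tf fn])
    have mono: "N n \<subseteq> N (n + d)" for n d
    proof (induction d)
      case (Suc d)
      have "N (n + d) \<subseteq> N (n + Suc d)" using mod_hom_zero[OF M M f] by (auto simp: N_def)
      with Suc show ?case by blast
    qed simp
    have surjn: "(f ^^ n) ` carrier M = carrier M" for n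
    proof (induction n)
      case (Suc n)
      have "(f ^^ Suc n) ` carrier M = f ` ((f ^^ n) ` carrier M)" by (simp only: funpow.simps image_comp)
      then show ?case by (simp only: Suc surj)
    qed simp
    fix x assume x: "x \<in> carrier M" "f x = \<zero>\<^bsub>M\<^esub>"
    obtain i j where ij: "i < j" "pivots m F \<pi> (N i) = pivots m F \<pi> (N j)" by (rule pivots_repeat)
    then have eq: "N i = N j"
      using mono[of i "j - i"] by (intro saturated_eq_if_pivots_eq sat) auto
    \<comment> \<open>Since f x = 0, the iterate i + 1 kills y. By stationarity the iterate i kills
      y as well, and it sends y to x.\<close>
    obtain y where y: "y \<in> carrier M" "x = (f ^^ i) y" using x surjn[of i] by blast
    then have "y \<in> N (Suc i)" using x by (simp add: N_def)
    then have "y \<in> N i" using mono[of "Suc i" "j - Suc i"] ij eq by auto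
    then show "x = \<zero>\<^bsub>M\<^esub>" using y by (simp add: N_def)
  qed
  then have "hopfian R M" by (auto simp: hopfian_def mod_iso_def bij_betw_def)
  moreover have "f ` carrier M = carrier M" if f: "f \<in> mod_hom R M M" and inj: "inj_on f (carrier M)" for f
  proof
    note fn = funpow_mod_hom[OF f]
    show "f ` carrier M \<subseteq> carrier M" using mod_hom_closed[OF f] by blast
    define N where "N n = (f ^^ n) ` carrier M" for n
    have sat: "saturated M (N n)" for n
      unfolding N_def by (rule saturated_image[OF M M dv tf fn])
    have anti: "N (n + d) \<subseteq> N n" for n d
      using mod_hom_closed[OF fn] by (auto simp: N_def funpow_add)
    have injn: "inj_on (f ^^ n) (carrier M)" for n
    proof (induction n)
      case (Suc n)
      then show ?case
        using inj mod_hom_closed[OF fn, of _ n] by (auto simp: inj_on_def)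
    qed simp
    obtain i j where ij: "i < j" "pivots m F \<pi> (N i) = pivots m F \<pi> (N j)" by (rule pivots_repeat)
    then have eq: "N j = N i"
      using anti[of i "j - i"] by (intro saturated_eq_if_pivots_eq sat) auto
    show "carrier M \<subseteq> f ` carrier M"
    proof
      fix y assume y: "y \<in> carrier M"
      \<comment> \<open>Stage i of the images equals stage i + 1, so the iterate i takes the same
        value at y and at some f z; its injectivity gives y = f z.\<close>
      then have "(f ^^ i) y \<in> N (Suc i)"
        using eq anti[of "Suc i" "j - Suc i"] ij by (auto simp: N_def)
      then obtain z where z: "z \<in> carrier M" "(f ^^ i) y = (f ^^ i) (f z)"
        by (auto simp: N_def funpow_swap1)
      then have "y = f z"
        using inj_onD[OF injn] y mod_hom_closed[OF f] by blast
      then show "y \<in> f ` carrier M" using z by blast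
    qed
  qed
  then have "co_hopfian R M" by (auto simp: co_hopfian_def mod_iso_def bij_betw_def)
  ultimately show ?thesis by (simp add: bi_hopfian_def)
qed

end

text \<open>Each summand is a line, so \<phi> followed by the projections gives one coordinate for
  each pair (P, i) with i < n P, finitely many in all.\<close>

lemma finite_sum_of_envelopes_bi_hopfian:
  fixes n :: "'a set \<Rightarrow> nat"
  assumes E: "injective_module R E"
    and F: "\<And>P. P \<in> minimal_primes R \<Longrightarrow> injective_envelope R (quot_module R P) (F P)"
    and \<phi>: "\<phi> \<in> mod_iso R E (module_direct_sum (minimal_primes R)
      (\<lambda>P. module_direct_sum {..<n P} (\<lambda>_. F P)))"
  shows "bi_hopfian R E"
proof -
  let ?D = "\<lambda>P. module_direct_sum {..<n P} (\<lambda>_. F P)"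
  let ?S = "module_direct_sum (minimal_primes R) ?D"
  let ?I = "SIGMA P:minimal_primes R. {..<n P}"
  interpret E: module R E using E by (simp add: injective_module_def)
  have mF: "module R (F P)" if "P \<in> minimal_primes R" for P
    using F[OF that] by (simp add: injective_envelope_def injective_module_def)
  have mD: "module R (?D P)" if "P \<in> minimal_primes R" for P
    by (rule module_direct_sum_is_module[OF is_cring mF[OF that]])
  have mS: "module R ?S" by (rule module_direct_sum_is_module[OF is_cring mD])
  have \<phi>h: "\<phi> \<in> mod_hom R E ?S" and \<phi>i: "inj_on \<phi> (carrier E)"
    using \<phi> by (auto simp: mod_iso_def bij_betw_def)
  have "finite ?I" by (intro finite_SigmaI finite_minimal_primes) simp
  \<comment> \<open>Pivots need linearly ordered coordinates, so the pairs (P, i) are numbered;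
    their order is immaterial.\<close>
  then obtain e where e: "bij_betw e {0..<card ?I} ?I" using ex_bij_betw_nat_finite by blast
  have eI: "fst (e k) \<in> minimal_primes R" "snd (e k) < n (fst (e k))" if "k < card ?I" for k
  proof -
    have "e k \<in> ?I" using bij_betw_apply[OF e] that by simp
    then show "fst (e k) \<in> minimal_primes R" "snd (e k) < n (fst (e k))" by auto
  qed
  show ?thesis
  proof (rule coordinates_bi_hopfian)
    show "module R E" ..
    show "divisible E" by (rule injective_imp_divisible[OF E])
    fix k assume k: "k < card ?I"
    let ?P = "fst (e k)"
    obtain u where u: "essential_generator ?P (F ?P) u"
      using injective_envelope_essential_generator[OF eI(1)[OF k] F[OF eI(1)[OF k]]] by blast
    show "module R (F ?P)" using mF eI(1)[OF k] .
    show "torsion_free (F ?P)"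
      by (rule generator_torsion_free[OF eI(1)[OF k] mF[OF eI(1)[OF k]] u])
    show "\<exists>s\<in>regs. \<exists>r\<in>carrier R. s \<odot>\<^bsub>F ?P\<^esub> y = r \<odot>\<^bsub>F ?P\<^esub> x"
      if "x \<in> carrier (F ?P)" "x \<noteq> \<zero>\<^bsub>F ?P\<^esub>" "y \<in> carrier (F ?P)" for x y
      using generator_one_dimensional[OF eI(1)[OF k] mF[OF eI(1)[OF k]] u that] .
    show "(\<lambda>x. \<phi> x ?P (snd (e k))) \<in> mod_hom R E (F ?P)"
      using mod_hom_compose[OF mod_hom_compose[OF \<phi>h direct_sum_projection[OF eI(1)[OF k]]]
          direct_sum_projection[of "snd (e k)" "{..<n ?P}"]] eI(2)[OF k] by simp
  next
    fix x assume x: "x \<in> carrier E"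
      and 0: "\<And>k. k < card ?I \<Longrightarrow> \<phi> x (fst (e k)) (snd (e k)) = \<zero>\<^bsub>F (fst (e k))\<^esub>"
    have \<phi>x: "\<phi> x \<in> carrier ?S" using mod_hom_closed[OF \<phi>h x] .
    have zS: "\<zero>\<^bsub>?S\<^esub> \<in> carrier ?S"
      using module.axioms(2)[OF mS] abelian_group.axioms(1) abelian_monoid.zero_closed by blast
    have "\<phi> x = \<zero>\<^bsub>?S\<^esub>"
    proof (rule direct_sum_eqI[OF \<phi>x zS])
      fix P assume P: "P \<in> minimal_primes R"
      note pr = direct_sum_projection[OF P, of R ?D]
      show "\<phi> x P = \<zero>\<^bsub>?S\<^esub> P"
      proof (rule direct_sum_eqI)
        show "\<phi> x P \<in> carrier (?D P)" using mod_hom_closed[OF pr \<phi>x] .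
        show "\<zero>\<^bsub>?S\<^esub> P \<in> carrier (?D P)" using mod_hom_closed[OF pr zS] .
        fix i assume i: "i \<in> {..<n P}"
        then have "(P, i) \<in> e ` {0..<card ?I}" using P e by (auto simp: bij_betw_def)
        then obtain k where k: "k < card ?I" "e k = (P, i)" by force
        show "\<phi> x P i = \<zero>\<^bsub>?S\<^esub> P i"
          using 0[OF k(1)] k(2) P i by (simp add: direct_sum_zero)
      qed
    qed
    then have "\<phi> x = \<phi> \<zero>\<^bsub>E\<^esub>" using mod_hom_zero[OF E.module_axioms mS \<phi>h] by simp
    then show "x = \<zero>\<^bsub>E\<^esub>" using inj_onD[OF \<phi>i] x by blast
  qed
qed

end

section \<open>Maps out of direct sums\<close>

text \<open>The sum runs over the support and not over I: the index set may be infinite, and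
  \<open>finsum\<close> over an infinite set is zero by convention.\<close>

definition sum_map :: "'i set \<Rightarrow> ('i \<Rightarrow> ('a, 'm, 'p) module_scheme) \<Rightarrow> ('a, 'n, 'q) module_scheme \<Rightarrow>
    ('i \<Rightarrow> 'm \<Rightarrow> 'n) \<Rightarrow> ('i \<Rightarrow> 'm) \<Rightarrow> 'n"
  where "sum_map I M N \<psi> x = (\<Oplus>\<^bsub>N\<^esub>i\<in>{i \<in> I. x i \<noteq> \<zero>\<^bsub>M i\<^esub>}. \<psi> i (x i))"

context
  fixes R :: "('a, 'k) ring_scheme" and I :: "'i set"
    and M :: "'i \<Rightarrow> ('a, 'm, 'p) module_scheme" and N :: "('a, 'n, 'q) module_scheme"
    and \<psi> :: "'i \<Rightarrow> 'm \<Rightarrow> 'n"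
  assumes M: "\<And>i. i \<in> I \<Longrightarrow> module R (M i)" and N: "module R N"
    and \<psi>: "\<And>i. i \<in> I \<Longrightarrow> \<psi> i \<in> mod_hom R (M i) N"
begin

interpretation N: module R N by (fact N)

lemma direct_sum_component: "x \<in> carrier (module_direct_sum I M) \<Longrightarrow> i \<in> I \<Longrightarrow> x i \<in> carrier (M i)"
  using mod_hom_closed[OF direct_sum_projection] .

lemma direct_sum_support: "x \<in> carrier (module_direct_sum I M) \<Longrightarrow> finite {i \<in> I. x i \<noteq> \<zero>\<^bsub>M i\<^esub>}"
  by (simp add: module_direct_sum_def)

text \<open>Serves additivity, where the sums for two elements and for their sum must run over one
  finite set.\<close>

lemma sum_map_superset:
  assumes x: "x \<in> carrier (module_direct_sum I M)" and A: "finite A" "A \<subseteq> I"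
    "\<And>i. i \<in> I \<Longrightarrow> x i \<noteq> \<zero>\<^bsub>M i\<^esub> \<Longrightarrow> i \<in> A"
  shows "sum_map I M N \<psi> x = (\<Oplus>\<^bsub>N\<^esub>i\<in>A. \<psi> i (x i))"
  unfolding sum_map_def
proof (rule N.M.add.finprod_mono_neutral_cong_left)
  show "\<psi> i (x i) = \<zero>\<^bsub>N\<^esub>" if "i \<in> A - {i \<in> I. x i \<noteq> \<zero>\<^bsub>M i\<^esub>}" for i
    using that A mod_hom_zero[OF M N \<psi>, of i] by auto
  show "(\<lambda>i. \<psi> i (x i)) \<in> A \<rightarrow> carrier N"
    using A mod_hom_closed[OF \<psi>] direct_sum_component[OF x] by blast
qed (use A in auto)

lemma sum_map_hom: "sum_map I M N \<psi> \<in> mod_hom R (module_direct_sum I M) N"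
proof (rule mod_homI)
  note c = mod_hom_closed[OF \<psi>] direct_sum_component
  interpret D: module R "module_direct_sum I M"
    using N.R.is_cring M by (rule module_direct_sum_is_module)
  fix x assume x: "x \<in> carrier (module_direct_sum I M)"
  let ?X = "{i \<in> I. x i \<noteq> \<zero>\<^bsub>M i\<^esub>}"
  have X: "finite ?X" using direct_sum_support[OF x] .
  show "sum_map I M N \<psi> x \<in> carrier N"
    unfolding sum_map_def using c x by (intro N.M.finsum_closed) blast
  show "sum_map I M N \<psi> (r \<odot>\<^bsub>module_direct_sum I M\<^esub> x) = r \<odot>\<^bsub>N\<^esub> sum_map I M N \<psi> x"
    if r: "r \<in> carrier R" for r
  proof -
    have "sum_map I M N \<psi> (r \<odot>\<^bsub>module_direct_sum I M\<^esub> x) =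
        (\<Oplus>\<^bsub>N\<^esub>i\<in>?X. \<psi> i ((r \<odot>\<^bsub>module_direct_sum I M\<^esub> x) i))"
      using D.smult_closed[OF r x] X module.smult_r_null[OF M r]
      by (intro sum_map_superset) (auto simp: mod_hom_smult[OF direct_sum_projection r x])
    also have "\<dots> = (\<Oplus>\<^bsub>N\<^esub>i\<in>?X. r \<odot>\<^bsub>N\<^esub> \<psi> i (x i))"
      using r x c
      by (intro N.M.finsum_cong')
        (auto simp: mod_hom_smult[OF \<psi>] mod_hom_smult[OF direct_sum_projection])
    also have "\<dots> = r \<odot>\<^bsub>N\<^esub> sum_map I M N \<psi> x"
      unfolding sum_map_def using r x X c by (intro N.finsum_smult_ldistr[symmetric]) auto
    finally show ?thesis .
  qed
  fix y assume y: "y \<in> carrier (module_direct_sum I M)"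
  let ?A = "?X \<union> {i \<in> I. y i \<noteq> \<zero>\<^bsub>M i\<^esub>}"
  have A: "finite ?A" using X direct_sum_support[OF y] by simp
  have z: "\<zero>\<^bsub>M i\<^esub> \<oplus>\<^bsub>M i\<^esub> \<zero>\<^bsub>M i\<^esub> = \<zero>\<^bsub>M i\<^esub>" if "i \<in> I" for i
  proof -
    interpret Mi: module R "M i" using M[OF that] .
    show ?thesis by simp
  qed
  have "sum_map I M N \<psi> (x \<oplus>\<^bsub>module_direct_sum I M\<^esub> y) =
      (\<Oplus>\<^bsub>N\<^esub>i\<in>?A. \<psi> i ((x \<oplus>\<^bsub>module_direct_sum I M\<^esub> y) i))"
    using D.M.a_closed[OF x y] A z
    by (intro sum_map_superset) (auto simp: mod_hom_add[OF direct_sum_projection x y])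
  also have "\<dots> = (\<Oplus>\<^bsub>N\<^esub>i\<in>?A. \<psi> i (x i) \<oplus>\<^bsub>N\<^esub> \<psi> i (y i))"
    using x y c
    by (intro N.M.finsum_cong')
      (auto simp: mod_hom_add[OF \<psi>] mod_hom_add[OF direct_sum_projection])
  also have "\<dots> = (\<Oplus>\<^bsub>N\<^esub>i\<in>?A. \<psi> i (x i)) \<oplus>\<^bsub>N\<^esub> (\<Oplus>\<^bsub>N\<^esub>i\<in>?A. \<psi> i (y i))"
    using x y c by (intro N.M.finsum_addf) auto
  also have "\<dots> = sum_map I M N \<psi> x \<oplus>\<^bsub>N\<^esub> sum_map I M N \<psi> y"
    using sum_map_superset[OF x A] sum_map_superset[OF y A] by auto
  finally show "sum_map I M N \<psi> (x \<oplus>\<^bsub>module_direct_sum I M\<^esub> y) =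
      sum_map I M N \<psi> x \<oplus>\<^bsub>N\<^esub> sum_map I M N \<psi> y" .
qed

lemma sum_map_single:
  assumes i: "i \<in> I" and v: "v \<in> carrier (M i)"
  shows "(\<lambda>j\<in>I. if j = i then v else \<zero>\<^bsub>M j\<^esub>) \<in> carrier (module_direct_sum I M)" (is "?x \<in> _")
    and "sum_map I M N \<psi> (\<lambda>j\<in>I. if j = i then v else \<zero>\<^bsub>M j\<^esub>) = \<psi> i v"
proof -
  have z: "\<zero>\<^bsub>M j\<^esub> \<in> carrier (M j)" if "j \<in> I" for j
    using abelian_monoid.zero_closed[OF abelian_group.axioms(1)[OF module.axioms(2)[OF M[OF that]]]] .
  have "finite {j \<in> I. ?x j \<noteq> \<zero>\<^bsub>M j\<^esub>}"
    by (rule finite_subset[of _ "{i}"]) auto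
  then show x: "?x \<in> carrier (module_direct_sum I M)"
    using z v by (simp add: module_direct_sum_def)
  have "sum_map I M N \<psi> ?x = (\<Oplus>\<^bsub>N\<^esub>j\<in>{i}. \<psi> j (?x j))"
    using i by (intro sum_map_superset x) (auto split: if_splits)
  also have "\<dots> = \<psi> i v"
    using i v mod_hom_closed[OF \<psi>[OF i]] by (subst N.M.finsum_insert) auto
  finally show "sum_map I M N \<psi> ?x = \<psi> i v" .
qed

end

lemma (in module) finsum_submodule_closed:
  assumes "submodule N R M" "finite A" "\<And>i. i \<in> A \<Longrightarrow> g i \<in> N"
  shows "(\<Oplus>\<^bsub>M\<^esub>i\<in>A. g i) \<in> N"
  using assms(2,3)
proof (induction A)
  case empty
  then show ?case using subgroup.one_closed[OF submodule.axioms(1)[OF assms(1)]] by simp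
next
  case (insert i A)
  then show ?case
    using submoduleE(1,5)[OF assms(1)] by (subst finsum_insert) auto
qed

lemma (in module) finsum_smult_submodule_closed:
  assumes N: "submodule N R M" and x: "x \<in> carrier M" and "finite A"
    and "\<And>i. i \<in> A \<Longrightarrow> g i \<in> carrier R" "\<And>i. i \<in> A \<Longrightarrow> g i \<odot>\<^bsub>M\<^esub> x \<in> N"
  shows "(\<Oplus>i\<in>A. g i) \<odot>\<^bsub>M\<^esub> x \<in> N"
  using assms(3-5)
proof (induction A)
  case empty
  then show ?case using subgroup.one_closed[OF submodule.axioms(1)[OF N]] x by simp
next
  case (insert i A)
  then have "(g i \<oplus> (\<Oplus>i\<in>A. g i)) \<odot>\<^bsub>M\<^esub> x \<in> N"
    using x submoduleE(5)[OF N] by (subst smult_l_distr) auto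
  with insert show ?case by (subst R.finsum_insert) auto
qed

section \<open>Bases of torsion-free divisible modules\<close>

context reduced_noetherian_ring
begin

text \<open>Quotients are chosen coordinatewise. Torsion-freeness makes every quotient of zero equal
  to zero, so the support does not grow and stays finite.\<close>

lemma direct_sum_divisible:
  assumes M: "\<And>i. i \<in> I \<Longrightarrow> module R (M i)" and dv: "\<And>i. i \<in> I \<Longrightarrow> divisible (M i)"
    and tf: "\<And>i. i \<in> I \<Longrightarrow> torsion_free (M i)"
  shows "divisible (module_direct_sum I M)"
  unfolding divisible_def
proof (intro ballI)
  fix s x assume s: "s \<in> regs" and x: "x \<in> carrier (module_direct_sum I M)"
  have xi: "x i \<in> carrier (M i)" if "i \<in> I" for i
    using mod_hom_closed[OF direct_sum_projection[OF that] x] .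
  have "\<exists>y. y \<in> carrier (M i) \<and> s \<odot>\<^bsub>M i\<^esub> y = x i" if "i \<in> I" for i
    using divisibleD[OF dv[OF that] s xi[OF that]] by blast
  then obtain y where y: "\<And>i. i \<in> I \<Longrightarrow> y i \<in> carrier (M i)" "\<And>i. i \<in> I \<Longrightarrow> s \<odot>\<^bsub>M i\<^esub> y i = x i"
    by metis
  have "y i = \<zero>\<^bsub>M i\<^esub>" if "i \<in> I" "x i = \<zero>\<^bsub>M i\<^esub>" for i
    using torsion_freeD[OF tf[OF that(1)] s y(1)[OF that(1)]] y(2) that by simp
  then have "{i \<in> I. y i \<noteq> \<zero>\<^bsub>M i\<^esub>} \<subseteq> {i \<in> I. x i \<noteq> \<zero>\<^bsub>M i\<^esub>}" by blast
  moreover have "finite {i \<in> I. x i \<noteq> \<zero>\<^bsub>M i\<^esub>}" using x by (simp add: module_direct_sum_def)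
  ultimately have "finite {i \<in> I. y i \<noteq> \<zero>\<^bsub>M i\<^esub>}" by (rule finite_subset)
  then have "restrict y I \<in> carrier (module_direct_sum I M)"
    using y by (auto simp: module_direct_sum_def cong: conj_cong)
  moreover have "s \<odot>\<^bsub>module_direct_sum I M\<^esub> restrict y I = x"
    using x y by (auto simp: module_direct_sum_def PiE_def extensional_def)
  ultimately show "\<exists>y\<in>carrier (module_direct_sum I M). s \<odot>\<^bsub>module_direct_sum I M\<^esub> y = x" by blast
qed

text \<open>The terms are asked to vanish, not the coefficients, because every coefficient in P
  kills an atom for P. In other words, the sum of the cyclic submodules spanned by the elements of B
  is direct.\<close>

definition lin_independent :: "('a, 'm, 'p) module_scheme \<Rightarrow> 'm set \<Rightarrow> bool" where
  "lin_independent M B \<longleftrightarrow> (\<forall>A r. finite A \<and> A \<subseteq> B \<and> r \<in> A \<rightarrow> carrier R \<and>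
     (\<Oplus>\<^bsub>M\<^esub>b\<in>A. r b \<odot>\<^bsub>M\<^esub> b) = \<zero>\<^bsub>M\<^esub> \<longrightarrow> (\<forall>b\<in>A. r b \<odot>\<^bsub>M\<^esub> b = \<zero>\<^bsub>M\<^esub>))"

lemma lin_independentD:
  "lin_independent M B \<Longrightarrow> finite A \<Longrightarrow> A \<subseteq> B \<Longrightarrow> r \<in> A \<rightarrow> carrier R \<Longrightarrow>
    (\<Oplus>\<^bsub>M\<^esub>b\<in>A. r b \<odot>\<^bsub>M\<^esub> b) = \<zero>\<^bsub>M\<^esub> \<Longrightarrow> b \<in> A \<Longrightarrow> r b \<odot>\<^bsub>M\<^esub> b = \<zero>\<^bsub>M\<^esub>"
  by (simp add: lin_independent_def)

text \<open>Zorn applies because a relation involves finitely many vectors, and a finite subset of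
  the union of a chain lies in one member.\<close>

lemma maximal_independent_atoms:
  fixes M :: "('a, 'm, 'p) module_scheme"
  shows "\<exists>B. (\<forall>b\<in>B. \<exists>P\<in>minimal_primes R. atom P M b) \<and> lin_independent M B \<and>
    (\<forall>b. (\<exists>P\<in>minimal_primes R. atom P M b) \<and> lin_independent M (insert b B) \<longrightarrow> b \<in> B)"
proof -
  define S where "S = {B. (\<forall>b\<in>B. \<exists>P\<in>minimal_primes R. atom P M b) \<and> lin_independent M B}"
  have "\<exists>B\<in>S. \<forall>B'\<in>S. B \<subseteq> B' \<longrightarrow> B' = B"
  proof (rule subset_Zorn_nonempty)
    have "{} \<in> S" by (simp add: S_def lin_independent_def)
    then show "S \<noteq> {}" by blast
    fix C assume C: "C \<noteq> {}" "subset.chain S C"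
    have "lin_independent M (\<Union>C)"
      unfolding lin_independent_def
    proof (intro allI impI, elim conjE)
      fix A r assume A: "finite A" "A \<subseteq> \<Union>C"
        and r: "r \<in> A \<rightarrow> carrier R" "(\<Oplus>\<^bsub>M\<^esub>b\<in>A. r b \<odot>\<^bsub>M\<^esub> b) = \<zero>\<^bsub>M\<^esub>"
      obtain B where B: "B \<in> C" "A \<subseteq> B"
        using finite_subset_Union_chain[OF A C] .
      then have "lin_independent M B" using C(2) by (auto simp: subset_chain_def S_def)
      then show "\<forall>b\<in>A. r b \<odot>\<^bsub>M\<^esub> b = \<zero>\<^bsub>M\<^esub>" 
        by (intro ballI lin_independentD[OF _ A(1) B(2) r])
    qed
    then show "\<Union>C \<in> S" using C(2) by (auto simp: subset_chain_def S_def)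
  qed
  then obtain B where B: "B \<in> S" "\<And>B'. B' \<in> S \<Longrightarrow> B \<subseteq> B' \<Longrightarrow> B' = B" by blast
  show ?thesis
  proof (intro exI[of _ B] conjI allI impI)
    show "b \<in> B" if "(\<exists>P\<in>minimal_primes R. atom P M b) \<and> lin_independent M (insert b B)" for b
    proof -
      have "insert b B \<in> S" using that B(1) by (auto simp: S_def)
      from B(2)[OF this] show ?thesis by blast
    qed
  qed (use B(1) in \<open>auto simp: S_def\<close>)
qed

lemma common_denominator:
  assumes "finite A" and F: "\<And>b. b \<in> A \<Longrightarrow> module R (F b)"
    and u: "\<And>b. b \<in> A \<Longrightarrow> u b \<in> carrier (F b)" and x: "\<And>b. b \<in> A \<Longrightarrow> x b \<in> carrier (F b)"
    and "\<And>b. b \<in> A \<Longrightarrow> \<exists>s\<in>regs. \<exists>r\<in>carrier R. s \<odot>\<^bsub>F b\<^esub> x b = r \<odot>\<^bsub>F b\<^esub> u b"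
  shows "\<exists>s\<in>regs. \<forall>b\<in>A. \<exists>r\<in>carrier R. s \<odot>\<^bsub>F b\<^esub> x b = r \<odot>\<^bsub>F b\<^esub> u b"
  using assms
proof (induction A)
  case empty
  then show ?case using one_regs by blast
next
  case (insert a A)
  then obtain s where s: "s \<in> regs" "\<forall>b\<in>A. \<exists>r\<in>carrier R. s \<odot>\<^bsub>F b\<^esub> x b = r \<odot>\<^bsub>F b\<^esub> u b"
    by (metis insertI2)
  obtain t r where t: "t \<in> regs" "r \<in> carrier R" "t \<odot>\<^bsub>F a\<^esub> x a = r \<odot>\<^bsub>F a\<^esub> u a"
    using insert.prems(4)[of a] by blast
  note sc = regs_closed[OF s(1)] and tc = regs_closed[OF t(1)]
  have "\<exists>r\<in>carrier R. (s \<otimes> t) \<odot>\<^bsub>F b\<^esub> x b = r \<odot>\<^bsub>F b\<^esub> u b" if b: "b \<in> insert a A" for b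
  proof -
    interpret Fb: module R "F b" using insert.prems(1) b by blast
    note c = insert.prems(2,3)[OF b]
    show ?thesis
    proof (cases "b = a")
      case True
      then have "(s \<otimes> t) \<odot>\<^bsub>F b\<^esub> x b = (s \<otimes> r) \<odot>\<^bsub>F b\<^esub> u b"
        using Fb.smult_assoc1[OF sc tc c(2)] Fb.smult_assoc1[OF sc t(2) c(1)] t(3) by simp
      then show ?thesis using sc t(2) by blast
    next
      case False
      then obtain q where q: "q \<in> carrier R" "s \<odot>\<^bsub>F b\<^esub> x b = q \<odot>\<^bsub>F b\<^esub> u b" using s(2) b by blast
      then have "(s \<otimes> t) \<odot>\<^bsub>F b\<^esub> x b = (t \<otimes> q) \<odot>\<^bsub>F b\<^esub> u b"
        using sc tc c by (simp add: Fb.smult_assoc1 m_comm[of s t])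
      then show ?thesis using tc q(1) by blast
    qed
  qed
  then show ?case using regs_mult[OF s(1) t(1)] by blast
qed

text \<open>N acts as a subspace that contains B but not b. In a relation involving b, the term of b
  lies in N. Were its coefficient outside P, some regular multiple of b would lie in N, and then b
  itself by saturation. So the coefficient is in P, the term vanishes, and a relation within B
  remains.\<close>

lemma independent_insert:
  assumes M: "module R M" and P: "P \<in> minimal_primes R" and b: "atom P M b"
    and B: "lin_independent M B" and N: "saturated M N" and BN: "B \<subseteq> N" and bN: "b \<notin> N"
  shows "lin_independent M (insert b B)"
  unfolding lin_independent_def
proof (intro allI impI, elim conjE)
  interpret M: module R M by fact
  have sN: "submodule N R M" using N by (simp add: saturated_def)
  note SN = M.submoduleE[OF sN]
  have bc: "b \<in> carrier M" and Pb: "\<And>p. p \<in> P \<Longrightarrow> p \<odot>\<^bsub>M\<^esub> b = \<zero>\<^bsub>M\<^esub>" using b by (auto simp: atom_def)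
  fix A r assume A: "finite A" "A \<subseteq> insert b B" and r: "r \<in> A \<rightarrow> carrier R"
    and sum: "(\<Oplus>\<^bsub>M\<^esub>b\<in>A. r b \<odot>\<^bsub>M\<^esub> b) = \<zero>\<^bsub>M\<^esub>"
  show "\<forall>b\<in>A. r b \<odot>\<^bsub>M\<^esub> b = \<zero>\<^bsub>M\<^esub>"
  proof (cases "b \<in> A")
    case False
    then show ?thesis 
      using A by (intro ballI lin_independentD[OF B A(1) _ r sum]) auto
  next
    case True
    define A' where "A' = A - {b}"
    have A': "finite A'" "A' \<subseteq> B" "b \<notin> A'" "A = insert b A'" "r \<in> A' \<rightarrow> carrier R"
      using A True r by (auto simp: A'_def)
    have rb: "r b \<in> carrier R" using r True by blast
    let ?y = "\<Oplus>\<^bsub>M\<^esub>c\<in>A'. r c \<odot>\<^bsub>M\<^esub> c"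
    have mem: "r c \<odot>\<^bsub>M\<^esub> c \<in> N" if "c \<in> A'" for c
      using that SN(4) A'(2,5) BN by blast
    have y: "?y \<in> N" by (rule M.finsum_submodule_closed[OF sN A'(1) mem])
    have yc: "?y \<in> carrier M" using y SN(1) by blast
    have eq: "r b \<odot>\<^bsub>M\<^esub> b \<oplus>\<^bsub>M\<^esub> ?y = \<zero>\<^bsub>M\<^esub>"
      using sum mem SN(1) rb bc A'(1,3) unfolding A'(4) by (subst (asm) M.M.finsum_insert) auto
    then have "r b \<odot>\<^bsub>M\<^esub> b = \<ominus>\<^bsub>M\<^esub> ?y"
      using rb bc yc M.M.minus_equality[of "r b \<odot>\<^bsub>M\<^esub> b" ?y] by simp
    then have rbN: "r b \<odot>\<^bsub>M\<^esub> b \<in> N" using SN(3) y by simp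
    have "r b \<in> P"
    proof (rule ccontr)
      assume "r b \<notin> P"
      then obtain d p where d: "d \<in> carrier R" "p \<in> P" "d \<otimes> r b \<oplus> p \<in> regs"
        using regular_combination[OF P rb] by blast
      have "(d \<otimes> r b \<oplus> p) \<odot>\<^bsub>M\<^esub> b = d \<odot>\<^bsub>M\<^esub> (r b \<odot>\<^bsub>M\<^esub> b)"
        using d rb bc Pb minimal_prime_closed[OF P d(2)] by (simp add: M.smult_l_distr M.smult_assoc1)
      also have "\<dots> \<in> N" using SN(4) d(1) rbN by blast
      finally show False using saturatedD[OF N d(3) bc] bN by blast
    qed
    then have rb0: "r b \<odot>\<^bsub>M\<^esub> b = \<zero>\<^bsub>M\<^esub>" by (rule Pb)
    then have y0: "?y = \<zero>\<^bsub>M\<^esub>" using eq yc by simp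
    have "r c \<odot>\<^bsub>M\<^esub> c = \<zero>\<^bsub>M\<^esub>" if "c \<in> A'" for c
      by (rule lin_independentD[OF B A'(1,2,5) y0 that])
    with rb0 show ?thesis by (auto simp: A'(4))
  qed
qed

text \<open>The basis vectors of E serve as the index set, and the generator of the summand at b is
  sent to b. Injectivity is independence of B after clearing denominators; surjectivity is
  maximality of B together with saturation of the image.\<close>

lemma injective_torsion_free_decomposition:
  fixes E :: "('a, 'm, 'p) module_scheme" and F :: "'a set \<Rightarrow> ('a, 'e, 'q) module_scheme"
  assumes E: "injective_module R E" and tf: "torsion_free E"
    and F: "\<And>P. P \<in> minimal_primes R \<Longrightarrow> injective_envelope R (quot_module R P) (F P)"
  shows "\<exists>(B :: 'm set) p. p \<in> B \<rightarrow> minimal_primes R \<and>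
    is_mod_iso R (module_direct_sum B (\<lambda>b. F (p b))) E"
proof -
  interpret E: module R E using E by (simp add: injective_module_def)
  have mF: "module R (F P)" if "P \<in> minimal_primes R" for P
    using F[OF that] by (simp add: injective_envelope_def injective_module_def)
  obtain u where u: "\<And>P. P \<in> minimal_primes R \<Longrightarrow> essential_generator P (F P) (u P)"
    using injective_envelope_essential_generator[OF _ F] by metis
  obtain B where B: "\<forall>b\<in>B. \<exists>P\<in>minimal_primes R. atom P E b" and indep: "lin_independent E B"
    and max: "\<forall>b. (\<exists>P\<in>minimal_primes R. atom P E b) \<and> lin_independent E (insert b B) \<longrightarrow> b \<in> B"
    using maximal_independent_atoms[of E] by (elim exE conjE) (rule that)
  obtain p where p: "\<And>b. b \<in> B \<Longrightarrow> p b \<in> minimal_primes R" "\<And>b. b \<in> B \<Longrightarrow> atom (p b) E b"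
    using B by metis
  have "\<exists>\<psi>. \<psi> \<in> mod_hom R (F (p b)) E \<and> inj_on \<psi> (carrier (F (p b))) \<and> \<psi> (u (p b)) = b"
    if "b \<in> B" for b
    using generator_embeds[OF p(1)[OF that] mF[OF p(1)[OF that]] u[OF p(1)[OF that]] E tf p(2)[OF that]]
    by blast
  then obtain \<psi> where \<psi>: "\<And>b. b \<in> B \<Longrightarrow> \<psi> b \<in> mod_hom R (F (p b)) E"
    and \<psi>i: "\<And>b. b \<in> B \<Longrightarrow> inj_on (\<psi> b) (carrier (F (p b)))"
    and \<psi>u: "\<And>b. b \<in> B \<Longrightarrow> \<psi> b (u (p b)) = b"
    by metis
  let ?M = "\<lambda>b. F (p b)"
  let ?D = "module_direct_sum B ?M"
  have M: "module R (?M b)" if "b \<in> B" for b using mF p(1) that by blast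
  interpret D: module R ?D using is_cring M by (rule module_direct_sum_is_module)
  define \<Phi> where "\<Phi> = sum_map B ?M E \<psi>"
  have \<Phi>: "\<Phi> \<in> mod_hom R ?D E"
    unfolding \<Phi>_def by (rule sum_map_hom[OF M E.module_axioms \<psi>])
  have xb: "x b \<in> carrier (?M b)" if "x \<in> carrier ?D" "b \<in> B" for x b
    using mod_hom_closed[OF direct_sum_projection[OF that(2)] that(1)] .
  have uc: "u (p b) \<in> carrier (?M b)" if "b \<in> B" for b
    using essential_generator_closed[OF u[OF p(1)[OF that]]] .
  have u0: "u (p b) \<noteq> \<zero>\<^bsub>?M b\<^esub>" if "b \<in> B" for b
  proof
    interpret Mb: module R "?M b" using M[OF that] .
    assume "u (p b) = \<zero>\<^bsub>?M b\<^esub>"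
    then have "\<one> \<in> p b"
      using essential_generator_eq_zero[OF u[OF p(1)[OF that]] one_closed] by simp
    then show False using minimal_prime_one[OF p(1)[OF that]] by blast
  qed
  have "inj_on \<Phi> (carrier ?D)"
  proof (rule mod_hom_inj_onI[OF D.module_axioms E.module_axioms \<Phi>])
    fix x assume x: "x \<in> carrier ?D" "\<Phi> x = \<zero>\<^bsub>E\<^esub>"
    define A where "A = {b \<in> B. x b \<noteq> \<zero>\<^bsub>?M b\<^esub>}"
    have A: "finite A" "A \<subseteq> B" using x(1) by (auto simp: A_def module_direct_sum_def)
    \<comment> \<open>Up to a regular factor each \<open>x b\<close> is a multiple of the generator.
      One factor s for the whole finite support turns s times \<open>\<Phi> x\<close> into a
      combination of elements of B.\<close>
    have "\<exists>s\<in>regs. \<forall>b\<in>A. \<exists>r\<in>carrier R. s \<odot>\<^bsub>?M b\<^esub> x b = r \<odot>\<^bsub>?M b\<^esub> u (p b)"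
    proof (rule common_denominator[OF A(1)])
      fix b assume "b \<in> A"
      then have b: "b \<in> B" using A by blast
      note pb = p(1)[OF b]
      show "module R (?M b)" "u (p b) \<in> carrier (?M b)" "x b \<in> carrier (?M b)"
        using M uc xb x b by blast+
      show "\<exists>s\<in>regs. \<exists>r\<in>carrier R. s \<odot>\<^bsub>?M b\<^esub> x b = r \<odot>\<^bsub>?M b\<^esub> u (p b)"
        by (rule generator_one_dimensional[OF pb mF[OF pb] u[OF pb] uc[OF b] u0[OF b] xb[OF x(1) b]])
    qed
    then obtain s r where s: "s \<in> regs"
      and r: "\<And>b. b \<in> A \<Longrightarrow> r b \<in> carrier R" "\<And>b. b \<in> A \<Longrightarrow> s \<odot>\<^bsub>?M b\<^esub> x b = r b \<odot>\<^bsub>?M b\<^esub> u (p b)"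
      by metis
    note sc = regs_closed[OF s]
    have rb: "s \<odot>\<^bsub>E\<^esub> \<psi> b (x b) = r b \<odot>\<^bsub>E\<^esub> b" if b: "b \<in> A" for b
    proof -
      have bB: "b \<in> B" using b A by blast
      have "s \<odot>\<^bsub>E\<^esub> \<psi> b (x b) = \<psi> b (s \<odot>\<^bsub>?M b\<^esub> x b)"
        using mod_hom_smult[OF \<psi>[OF bB] sc xb[OF x(1) bB]] by simp
      also have "\<dots> = r b \<odot>\<^bsub>E\<^esub> b"
        unfolding r(2)[OF b] using mod_hom_smult[OF \<psi>[OF bB] r(1)[OF b] uc[OF bB]] \<psi>u[OF bB] by simp
      finally show ?thesis .
    qed
    have \<psi>x: "\<psi> b (x b) \<in> carrier E" if "b \<in> A" for b
      using mod_hom_closed[OF \<psi> xb[OF x(1)]] that A by blast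
    have "(\<Oplus>\<^bsub>E\<^esub>b\<in>A. r b \<odot>\<^bsub>E\<^esub> b) = (\<Oplus>\<^bsub>E\<^esub>b\<in>A. s \<odot>\<^bsub>E\<^esub> \<psi> b (x b))"
      using rb \<psi>x sc by (intro E.M.finsum_cong') auto
    also have "\<dots> = s \<odot>\<^bsub>E\<^esub> \<Phi> x"
      unfolding \<Phi>_def sum_map_def A_def[symmetric]
      using A(1) sc \<psi>x by (intro E.finsum_smult_ldistr[symmetric]) auto
    also have "\<dots> = \<zero>\<^bsub>E\<^esub>" using x sc by simp
    finally have sum: "(\<Oplus>\<^bsub>E\<^esub>b\<in>A. r b \<odot>\<^bsub>E\<^esub> b) = \<zero>\<^bsub>E\<^esub>" .
    have "r b \<odot>\<^bsub>E\<^esub> b = \<zero>\<^bsub>E\<^esub>" if "b \<in> A" for b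
      by (rule lin_independentD[OF indep A _ sum that]) (use r(1) in blast)
    then have \<psi>0: "\<psi> b (x b) = \<zero>\<^bsub>E\<^esub>" if "b \<in> A" for b
      using torsion_freeD[OF tf s \<psi>x[OF that]] rb that by simp
    have "b \<notin> A" for b
    proof
      assume bA: "b \<in> A"
      then have b: "b \<in> B" using A by blast
      interpret Mb: module R "?M b" using M[OF b] .
      have "\<psi> b (x b) = \<psi> b \<zero>\<^bsub>?M b\<^esub>"
        using \<psi>0[OF bA] mod_hom_zero[OF M[OF b] E.module_axioms \<psi>[OF b]] by simp
      then have "x b = \<zero>\<^bsub>?M b\<^esub>"
        using inj_onD[OF \<psi>i[OF b]] xb[OF x(1) b] Mb.M.zero_closed by blast
      then show False using bA by (simp add: A_def)
    qed
    then show "x = \<zero>\<^bsub>?D\<^esub>"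
      using x(1) by (intro direct_sum_eqI[OF x(1) D.M.zero_closed]) (auto simp: A_def direct_sum_zero)
  qed
  moreover have "\<Phi> ` carrier ?D = carrier E"
  proof
    show "\<Phi> ` carrier ?D \<subseteq> carrier E" using mod_hom_closed[OF \<Phi>] by blast
    define N where "N = \<Phi> ` carrier ?D"
    have "divisible ?D"
    proof (rule direct_sum_divisible[OF M])
      fix b assume b: "b \<in> B"
      note pb = p(1)[OF b]
      show "torsion_free (?M b)" by (rule generator_torsion_free[OF pb mF[OF pb] u[OF pb]])
      show "divisible (?M b)"
        using F[OF pb] by (intro injective_imp_divisible) (simp add: injective_envelope_def)
    qed
    then have N: "saturated E N"
      unfolding N_def by (rule saturated_image[OF D.module_axioms E.module_axioms _ tf \<Phi>])
    have BN: "B \<subseteq> N"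
    proof
      fix b assume b: "b \<in> B"
      let ?x = "\<lambda>j\<in>B. if j = b then u (p b) else \<zero>\<^bsub>?M j\<^esub>"
      have "?x \<in> carrier ?D"
        by (rule sum_map_single(1)[where R = R and N = E and M = ?M and \<psi> = \<psi>])
          (use M E.module_axioms \<psi> b uc in auto)
      moreover have "\<Phi> ?x = \<psi> b (u (p b))"
        unfolding \<Phi>_def by (rule sum_map_single(2)[where R = R and N = E and M = ?M and \<psi> = \<psi>])
          (use M E.module_axioms \<psi> b uc in auto)
      ultimately show "b \<in> N"
        unfolding N_def using \<psi>u[OF b] by (intro image_eqI[of _ _ ?x]) simp_all
    qed
    \<comment> \<open>Outside N this vector would be a nonzero vector killed by P that can be
      adjoined to B; maximality would then put it in B, which lies in N.\<close>
    have atoms: "isolating P \<odot>\<^bsub>E\<^esub> x \<in> N" if P: "P \<in> minimal_primes R" and x: "x \<in> carrier E" for P x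
    proof (rule ccontr)
      let ?b = "isolating P \<odot>\<^bsub>E\<^esub> x"
      note a = isolating_closed[OF P]
      assume bN: "?b \<notin> N"
      have z: "\<zero>\<^bsub>E\<^esub> \<in> N"
        using mod_hom_zero[OF D.module_axioms E.module_axioms \<Phi>] D.M.zero_closed
        unfolding N_def by (metis image_eqI)
      have "q \<odot>\<^bsub>E\<^esub> ?b = \<zero>\<^bsub>E\<^esub>" if q: "q \<in> P" for q
        using isolating_annihilates[OF P q] minimal_prime_closed[OF P q] a x
        by (simp add: E.smult_assoc1[symmetric])
      then have b: "atom P E ?b" using a x z bN by (auto simp: atom_def)
      have "?b \<in> B"
        using max[rule_format, OF conjI,
            OF bexI[of "\<lambda>P. atom P E ?b", OF b P] independent_insert[OF E.module_axioms P b indep N BN bN]] .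
      then show False using BN bN by blast
    qed
    show "carrier E \<subseteq> \<Phi> ` carrier ?D"
    proof
      fix x assume x: "x \<in> carrier E"
      \<comment> \<open>The sum of all isolating elements is regular, and its product with x is a
        sum of vectors just shown to lie in N; saturation yields x. The factors
        \<open>\<one>\<close> only match the shape of the combination lemma.\<close>
      let ?s = "\<Oplus>P\<in>minimal_primes R. \<one> \<otimes> isolating P"
      have s: "?s \<in> regs"
        by (rule isolating_combination_regs) (use minimal_prime_one in auto)
      have "?s \<odot>\<^bsub>E\<^esub> x \<in> N"
        using N finite_minimal_primes isolating_closed atoms[OF _ x] x
        by (intro E.finsum_smult_submodule_closed) (auto simp: saturated_def)
      then show "x \<in> \<Phi> ` carrier ?D" using saturatedD[OF N s x] by (simp add: N_def)
    qed
  qed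
  ultimately have "is_mod_iso R ?D E"
    using \<Phi> by (auto simp: is_mod_iso_def mod_iso_def bij_betw_def)
  then show ?thesis using p(1) by blast
qed

end

section \<open>Finiteness of the multiplicities\<close>

text \<open>Hilbert's hotel: reindexing by \<sigma> forgets exactly the coordinate a. It is onto
  because \<sigma> is injective, and its kernel is the summand at a.\<close>

lemma hopfian_direct_sum_shift:
  assumes R: "cring R" and M: "\<And>i. i \<in> I \<Longrightarrow> module R (M i)"
    and hopf: "hopfian R (module_direct_sum I M)"
    and a: "a \<in> I" and \<sigma>: "bij_betw \<sigma> I (I - {a})" and M\<sigma>: "\<And>i. i \<in> I \<Longrightarrow> M (\<sigma> i) = M i"
  shows "carrier (M a) = {\<zero>\<^bsub>M a\<^esub>}"
proof -
  let ?D = "module_direct_sum I M"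
  interpret D: module R ?D using R M by (rule module_direct_sum_is_module)
  have z: "\<zero>\<^bsub>M i\<^esub> \<in> carrier (M i)" if "i \<in> I" for i
    using abelian_monoid.zero_closed[OF abelian_group.axioms(1)[OF module.axioms(2)[OF M[OF that]]]] .
  define \<tau> where "\<tau> = inv_into I \<sigma>"
  have \<sigma>I: "\<sigma> i \<in> I" "\<sigma> i \<noteq> a" "\<tau> (\<sigma> i) = i" if "i \<in> I" for i
    using bij_betw_apply[OF \<sigma> that] bij_betw_inv_into_left[OF \<sigma> that] by (auto simp: \<tau>_def)
  have \<tau>I: "\<tau> j \<in> I" "\<sigma> (\<tau> j) = j" if "j \<in> I" "j \<noteq> a" for j
    using bij_betw_apply[OF bij_betw_inv_into[OF \<sigma>], of j] bij_betw_inv_into_right[OF \<sigma>, of j] that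
    by (auto simp: \<tau>_def)
  have xi: "x i \<in> carrier (M i)" if "x \<in> carrier ?D" "i \<in> I" for x i
    using that by (auto simp: module_direct_sum_def)
  have supp: "finite {i \<in> I. x i \<noteq> \<zero>\<^bsub>M i\<^esub>}" if "x \<in> carrier ?D" for x
    using that by (simp add: module_direct_sum_def)
  have mem: "restrict g I \<in> carrier ?D"
    if "\<And>i. i \<in> I \<Longrightarrow> g i \<in> carrier (M i)" "finite {i \<in> I. g i \<noteq> \<zero>\<^bsub>M i\<^esub>}" for g
    using that by (auto simp: module_direct_sum_def cong: conj_cong)
  define f where "f x = (\<lambda>i\<in>I. x (\<sigma> i))" for x :: "'c \<Rightarrow> 'd"
  have fmem: "f x \<in> carrier ?D" if x: "x \<in> carrier ?D" for x
    unfolding f_def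
  proof (rule mem)
    show "x (\<sigma> i) \<in> carrier (M i)" if "i \<in> I" for i
      using xi[OF x \<sigma>I(1)[OF that]] M\<sigma>[OF that] by simp
    have "{i \<in> I. x (\<sigma> i) \<noteq> \<zero>\<^bsub>M i\<^esub>} \<subseteq> \<tau> ` {i \<in> I. x i \<noteq> \<zero>\<^bsub>M i\<^esub>}"
    proof
      fix i assume i: "i \<in> {i \<in> I. x (\<sigma> i) \<noteq> \<zero>\<^bsub>M i\<^esub>}"
      then show "i \<in> \<tau> ` {i \<in> I. x i \<noteq> \<zero>\<^bsub>M i\<^esub>}"
        using \<sigma>I M\<sigma> by (intro image_eqI[of _ _ "\<sigma> i"]) auto
    qed
    then show "finite {i \<in> I. x (\<sigma> i) \<noteq> \<zero>\<^bsub>M i\<^esub>}"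
      using supp[OF x] by (blast intro: finite_subset)
  qed
  have f: "f \<in> mod_hom R ?D ?D"
  proof (rule mod_homI)
    fix x y assume "x \<in> carrier ?D" "y \<in> carrier ?D"
    then show "f (x \<oplus>\<^bsub>?D\<^esub> y) = f x \<oplus>\<^bsub>?D\<^esub> f y"
      using \<sigma>I M\<sigma> by (auto simp: f_def module_direct_sum_def intro!: restrict_ext)
  next
    fix r x assume "r \<in> carrier R" "x \<in> carrier ?D"
    then show "f (r \<odot>\<^bsub>?D\<^esub> x) = r \<odot>\<^bsub>?D\<^esub> f x"
      using \<sigma>I M\<sigma> by (auto simp: f_def module_direct_sum_def intro!: restrict_ext)
  qed (fact fmem)
  have "carrier ?D \<subseteq> f ` carrier ?D"
  proof
    fix y assume y: "y \<in> carrier ?D"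
    \<comment> \<open>A preimage of y: coordinates move back along the inverse of \<sigma>, and the
      vacant place a receives 0.\<close>
    define x where "x = (\<lambda>j\<in>I. if j = a then \<zero>\<^bsub>M j\<^esub> else y (\<tau> j))"
    have x: "x \<in> carrier ?D"
      unfolding x_def
    proof (rule mem)
      show "(if j = a then \<zero>\<^bsub>M j\<^esub> else y (\<tau> j)) \<in> carrier (M j)" if "j \<in> I" for j
        using xi[OF y \<tau>I(1)[OF that]] M\<sigma>[OF \<tau>I(1)[OF that]] \<tau>I(2)[OF that] z[OF that] by auto
      have "{j \<in> I. (if j = a then \<zero>\<^bsub>M j\<^esub> else y (\<tau> j)) \<noteq> \<zero>\<^bsub>M j\<^esub>} \<subseteq> \<sigma> ` {i \<in> I. y i \<noteq> \<zero>\<^bsub>M i\<^esub>}"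
      proof
        fix j assume j: "j \<in> {j \<in> I. (if j = a then \<zero>\<^bsub>M j\<^esub> else y (\<tau> j)) \<noteq> \<zero>\<^bsub>M j\<^esub>}"
        then have ja: "j \<in> I" "j \<noteq> a" by (auto split: if_splits)
        then show "j \<in> \<sigma> ` {i \<in> I. y i \<noteq> \<zero>\<^bsub>M i\<^esub>}"
          using j \<tau>I[OF ja] M\<sigma>[OF \<tau>I(1)[OF ja]] by (intro image_eqI[of _ _ "\<tau> j"]) auto
      qed
      then show "finite {j \<in> I. (if j = a then \<zero>\<^bsub>M j\<^esub> else y (\<tau> j)) \<noteq> \<zero>\<^bsub>M j\<^esub>}"
        using supp[OF y] by (blast intro: finite_subset)
    qed
    have "f x = y"
      by (rule direct_sum_eqI[OF fmem[OF x] y]) (simp add: f_def x_def \<sigma>I)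
    then show "y \<in> f ` carrier ?D" using x by blast
  qed
  then have "f ` carrier ?D = carrier ?D" using fmem by blast
  then have inj: "inj_on f (carrier ?D)"
    using hopf f by (auto simp: hopfian_def mod_iso_def bij_betw_def)
  have "v = \<zero>\<^bsub>M a\<^esub>" if v: "v \<in> carrier (M a)" for v
  proof -
    define x where "x = (\<lambda>j\<in>I. if j = a then v else \<zero>\<^bsub>M j\<^esub>)"
    have x: "x \<in> carrier ?D"
      unfolding x_def
    proof (rule mem)
      show "finite {j \<in> I. (if j = a then v else \<zero>\<^bsub>M j\<^esub>) \<noteq> \<zero>\<^bsub>M j\<^esub>}"
        by (rule finite_subset[of _ "{a}"]) auto
    qed (use v z in auto)
    have "f x = f \<zero>\<^bsub>?D\<^esub>"
      using \<sigma>I by (auto simp: f_def x_def direct_sum_zero intro!: restrict_ext)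
    then have "x = \<zero>\<^bsub>?D\<^esub>" using inj_onD[OF inj] x by blast
    then have "x a = \<zero>\<^bsub>M a\<^esub>" using direct_sum_zero[OF a, of M] by simp
    then show ?thesis using a by (simp add: x_def)
  qed
  then show ?thesis using z[OF a] by blast
qed

text \<open>All index sets are finite, so finite support is automatic on both sides and only
  coordinates are renamed.\<close>

lemma direct_sum_regroup:
  fixes M :: "'i \<Rightarrow> ('a, 'm, 'p) module_scheme"
  assumes J: "finite J" and K: "\<And>j. j \<in> J \<Longrightarrow> finite (K j)"
    and \<beta>: "bij_betw (\<lambda>(j, k). \<beta> j k) (Sigma J K) B"
    and M: "\<And>j k. j \<in> J \<Longrightarrow> k \<in> K j \<Longrightarrow> M (\<beta> j k) = N j"
  shows "(\<lambda>x. \<lambda>j\<in>J. \<lambda>k\<in>K j. x (\<beta> j k)) \<in>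
    mod_iso R (module_direct_sum B M) (module_direct_sum J (\<lambda>j. module_direct_sum (K j) (\<lambda>_. N j)))"
    (is "?f \<in> mod_iso R ?D ?S")
proof -
  have fB: "finite B" using bij_betw_finite[OF \<beta>] J K by auto
  have \<beta>B: "\<beta> j k \<in> B" if "j \<in> J" "k \<in> K j" for j k
    using bij_betw_apply[OF \<beta>, of "(j, k)"] that by simp
  have \<beta>E: "\<exists>j\<in>J. \<exists>k\<in>K j. b = \<beta> j k" if "b \<in> B" for b
    using that \<beta> by (auto simp: bij_betw_def)
  have xB: "x (\<beta> j k) \<in> carrier (N j)" if "x \<in> carrier ?D" "j \<in> J" "k \<in> K j" for x j k
    using that \<beta>B[OF that(2,3)] M[OF that(2,3)] by (auto simp: module_direct_sum_def dest: PiE_mem)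
  have f: "?f \<in> mod_hom R ?D ?S"
  proof (rule mod_homI)
    fix x assume x: "x \<in> carrier ?D"
    show "?f x \<in> carrier ?S"
      using xB[OF x] J K by (auto simp: module_direct_sum_def)
    show "?f (r \<odot>\<^bsub>?D\<^esub> x) = r \<odot>\<^bsub>?S\<^esub> ?f x" for r
      using \<beta>B M by (auto simp: module_direct_sum_def intro!: restrict_ext)
    fix y assume y: "y \<in> carrier ?D"
    show "?f (x \<oplus>\<^bsub>?D\<^esub> y) = ?f x \<oplus>\<^bsub>?S\<^esub> ?f y"
      using \<beta>B M by (auto simp: module_direct_sum_def intro!: restrict_ext)
  qed
  moreover have "inj_on ?f (carrier ?D)"
  proof (rule inj_onI)
    fix x y assume x: "x \<in> carrier ?D" and y: "y \<in> carrier ?D" and eq: "?f x = ?f y"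
    show "x = y"
    proof (rule direct_sum_eqI[OF x y])
      fix b assume "b \<in> B"
      then obtain j k where jk: "j \<in> J" "k \<in> K j" "b = \<beta> j k" using \<beta>E by blast
      have "?f x j k = ?f y j k" by (simp only: eq)
      then show "x b = y b" using jk by simp
    qed
  qed
  moreover have "?f ` carrier ?D = carrier ?S"
  proof
    show "?f ` carrier ?D \<subseteq> carrier ?S" using mod_hom_closed[OF f] by blast
    show "carrier ?S \<subseteq> ?f ` carrier ?D"
    proof
      fix y assume y: "y \<in> carrier ?S"
      define g where "g = inv_into (Sigma J K) (\<lambda>(j, k). \<beta> j k)"
      have g: "g (\<beta> j k) = (j, k)" if "j \<in> J" "k \<in> K j" for j k
        using bij_betw_inv_into_left[OF \<beta>, of "(j, k)"] that by (simp add: g_def)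
      define x where "x = (\<lambda>b\<in>B. y (fst (g b)) (snd (g b)))"
      have yjk: "y j k \<in> carrier (N j)" if "j \<in> J" "k \<in> K j" for j k
        using mod_hom_closed[OF direct_sum_projection[OF that(2)]
            mod_hom_closed[OF direct_sum_projection[OF that(1)] y]] .
      have xjk: "x (\<beta> j k) = y j k" if "j \<in> J" "k \<in> K j" for j k
        using that \<beta>B g by (simp add: x_def)
      have "x b \<in> carrier (M b)" if "b \<in> B" for b
        using \<beta>E[OF that] xjk yjk M by auto
      then have x: "x \<in> carrier ?D"
        using fB by (auto simp: module_direct_sum_def x_def)
      have "?f x = y"
      proof (rule direct_sum_eqI[OF mod_hom_closed[OF f x] y])
        fix j assume j: "j \<in> J"
        show "?f x j = y j"
          by (rule direct_sum_eqI[OF mod_hom_closed[OF direct_sum_projection[OF j] mod_hom_closed[OF f x]]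
                mod_hom_closed[OF direct_sum_projection[OF j] y]]) (use j xjk in simp)
      qed
      then show "y \<in> ?f ` carrier ?D" using x by blast
    qed
  qed
  ultimately show ?thesis by (simp add: mod_iso_def bij_betw_def)
qed

text \<open>The multiplicity of P is the number of basis vectors that belong to P.\<close>

lemma (in reduced_noetherian_ring) injective_hopfian_decomposition:
  fixes E :: "('a, 'm, 'p) module_scheme" and F :: "'a set \<Rightarrow> ('a, 'e, 'q) module_scheme"
  assumes E: "injective_module R E" and hopf: "hopfian R E"
    and F: "\<And>P. P \<in> minimal_primes R \<Longrightarrow> injective_envelope R (quot_module R P) (F P)"
  shows "\<exists>n :: 'a set \<Rightarrow> nat. is_mod_iso R E
    (module_direct_sum (minimal_primes R) (\<lambda>P. module_direct_sum {..<n P} (\<lambda>_. F P)))"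
proof -
  interpret E: module R E using E by (simp add: injective_module_def)
  have mF: "module R (F P)" if "P \<in> minimal_primes R" for P
    using F[OF that] by (simp add: injective_envelope_def injective_module_def)
  \<comment> \<open>The shift argument only shows that a summand is zero; a contradiction needs the
    envelopes to be nonzero.\<close>
  have nontrivial: "carrier (F P) \<noteq> {\<zero>\<^bsub>F P\<^esub>}" if P: "P \<in> minimal_primes R" for P
  proof
    interpret FP: module R "F P" using mF[OF P] .
    obtain u where u: "essential_generator P (F P) u"
      using injective_envelope_essential_generator[OF P F[OF P]] by blast
    assume "carrier (F P) = {\<zero>\<^bsub>F P\<^esub>}"
    then have "\<one> \<odot>\<^bsub>F P\<^esub> u = \<zero>\<^bsub>F P\<^esub>" using essential_generator_closed[OF u] by simp
    then show False
      using essential_generator_eq_zero[OF u one_closed] minimal_prime_one[OF P] by blast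
  qed
  obtain B :: "'m set" and p where pB: "p \<in> B \<rightarrow> minimal_primes R"
    and "is_mod_iso R (module_direct_sum B (\<lambda>b. F (p b))) E"
    using injective_torsion_free_decomposition[OF E injective_hopfian_imp_torsion_free[OF E hopf], of F] F
    by blast
  then obtain \<Phi> where \<Phi>: "\<Phi> \<in> mod_iso R (module_direct_sum B (\<lambda>b. F (p b))) E"
    by (auto simp: is_mod_iso_def)
  have p: "p b \<in> minimal_primes R" if "b \<in> B" for b using pB that by blast
  let ?D = "module_direct_sum B (\<lambda>b. F (p b))"
  have M: "module R (F (p b))" if "b \<in> B" for b using mF p that by blast
  have D: "module R ?D" using is_cring M by (rule module_direct_sum_is_module)
  note \<Phi>' = mod_iso_inverse[OF D \<Phi>]
  have hopfD: "hopfian R ?D" by (rule hopfian_iso[OF E.module_axioms \<Phi>' hopf])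
  define BP where "BP P = {b \<in> B. p b = P}" for P
  have fin: "finite (BP P)" if P: "P \<in> minimal_primes R" for P
  proof (rule ccontr)
    assume inf: "infinite (BP P)"
    then obtain a where a: "a \<in> BP P" using infinite_imp_nonempty by blast
    obtain h where h: "bij_betw h (BP P) (BP P - {a})" using infinite_imp_bij_betw[OF inf] by blast
    \<comment> \<open>Extended by the identity outside \<open>BP P\<close>, the bijection of the
      infinite set \<open>BP P\<close> onto itself minus a becomes a shift of B that preserves the
      prime of each index, and with it the summand.\<close>
    define \<sigma> where "\<sigma> b = (if b \<in> BP P then h b else b)" for b
    have "bij_betw \<sigma> (BP P \<union> (B - BP P)) ((BP P - {a}) \<union> (B - BP P))"
    proof (rule bij_betw_combine)
      show "bij_betw \<sigma> (BP P) (BP P - {a})"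
        using h by (subst bij_betw_cong[of _ _ h]) (simp_all add: \<sigma>_def)
      show "bij_betw \<sigma> (B - BP P) (B - BP P)"
        by (subst bij_betw_cong[of _ _ id]) (simp_all add: \<sigma>_def)
    qed auto
    moreover have "BP P \<union> (B - BP P) = B" "(BP P - {a}) \<union> (B - BP P) = B - {a}"
      using a by (auto simp: BP_def)
    ultimately have \<sigma>: "bij_betw \<sigma> B (B - {a})" by simp
    have "F (p (\<sigma> b)) = F (p b)" for b
      using bij_betw_apply[OF h, of b] by (auto simp: \<sigma>_def BP_def)
    then have "carrier (F (p a)) = {\<zero>\<^bsub>F (p a)\<^esub>}"
      using a by (intro hopfian_direct_sum_shift[OF is_cring M hopfD _ \<sigma>]) (auto simp: BP_def)
    then show False using nontrivial[OF P] a by (simp add: BP_def)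
  qed
  have "\<exists>h. bij_betw h {..<card (BP P)} (BP P)" if "P \<in> minimal_primes R" for P
    using ex_bij_betw_nat_finite[OF fin[OF that]] by (simp add: atLeast0LessThan)
  then obtain \<beta> where \<beta>: "\<And>P. P \<in> minimal_primes R \<Longrightarrow> bij_betw (\<beta> P) {..<card (BP P)} (BP P)"
    by metis
  have \<beta>B: "\<beta> P k \<in> B" "p (\<beta> P k) = P" if "P \<in> minimal_primes R" "k < card (BP P)" for P k
    using bij_betw_apply[OF \<beta>[OF that(1)], of k] that(2) by (auto simp: BP_def)
  have bij: "bij_betw (\<lambda>(P, k). \<beta> P k) (SIGMA P:minimal_primes R. {..<card (BP P)}) B"
  proof (rule bij_betw_imageI)
    show "inj_on (\<lambda>(P, k). \<beta> P k) (SIGMA P:minimal_primes R. {..<card (BP P)})"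
    proof (rule inj_onI, clarify)
      fix P k Q l assume *: "P \<in> minimal_primes R" "k < card (BP P)" "Q \<in> minimal_primes R"
        "l < card (BP Q)" "\<beta> P k = \<beta> Q l"
      then have "P = Q" using \<beta>B(2) by metis
      with * show "P = Q \<and> k = l"
        using \<beta>[OF *(1)] by (auto simp: bij_betw_def dest: inj_onD)
    qed
    show "(\<lambda>(P, k). \<beta> P k) ` (SIGMA P:minimal_primes R. {..<card (BP P)}) = B"
    proof
      show "(\<lambda>(P, k). \<beta> P k) ` (SIGMA P:minimal_primes R. {..<card (BP P)}) \<subseteq> B"
        using \<beta>B(1) by auto
      show "B \<subseteq> (\<lambda>(P, k). \<beta> P k) ` (SIGMA P:minimal_primes R. {..<card (BP P)})"
      proof
        fix b assume b: "b \<in> B"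
        then have "b \<in> \<beta> (p b) ` {..<card (BP (p b))}"
          using \<beta>[OF p[OF b]] by (simp add: bij_betw_def BP_def)
        then obtain k where "k < card (BP (p b))" "b = \<beta> (p b) k" by blast
        then show "b \<in> (\<lambda>(P, k). \<beta> P k) ` (SIGMA P:minimal_primes R. {..<card (BP P)})"
          using p[OF b] by (intro image_eqI[of _ _ "(p b, k)"]) auto
      qed
    qed
  qed
  have "(\<lambda>x. \<lambda>P\<in>minimal_primes R. \<lambda>k\<in>{..<card (BP P)}. x (\<beta> P k)) \<in> mod_iso R ?D
      (module_direct_sum (minimal_primes R) (\<lambda>P. module_direct_sum {..<card (BP P)} (\<lambda>_. F P)))"
    using \<beta>B(2) by (intro direct_sum_regroup finite_minimal_primes bij) auto
  from mod_iso_compose[OF \<Phi>' this] show ?thesis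
    unfolding is_mod_iso_def by (intro exI[of _ "\<lambda>P. card (BP P)"]) blast
qed

theorem corollary2p6:
  fixes R :: "('a, 'k) ring_scheme"
    and E :: "('a, 'm, 'p) module_scheme"
    and EP :: "'a set \<Rightarrow> ('a, 'e, 'q) module_scheme"
  assumes "cring R" and "\<one>\<^bsub>R\<^esub> \<noteq> \<zero>\<^bsub>R\<^esub>"
    and "noetherian_ring R"
    and "reduced_ring R"
    and "\<not> field R"
    and "injective_module R E"
    and EP: "\<And>P. P \<in> minimal_primes R \<Longrightarrow> injective_envelope R (quot_module R P) (EP P)"
  shows "bi_hopfian R E \<longleftrightarrow>
    (\<exists>n :: 'a set \<Rightarrow> nat.
       is_mod_iso R E
         (module_direct_sum (minimal_primes R)
            (\<lambda>P. module_direct_sum {..<n P} (\<lambda>_. EP P))))"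
proof -
  interpret reduced_noetherian_ring R
    using assms by (simp add: reduced_noetherian_ring_def reduced_noetherian_ring_axioms_def)
  show ?thesis
  proof
    assume "bi_hopfian R E"
    then have "hopfian R E" by (simp add: bi_hopfian_def)
    with \<open>injective_module R E\<close> show "\<exists>n :: 'a set \<Rightarrow> nat. is_mod_iso R E
        (module_direct_sum (minimal_primes R) (\<lambda>P. module_direct_sum {..<n P} (\<lambda>_. EP P)))"
      by (rule injective_hopfian_decomposition) (rule EP)
  next
    assume "\<exists>n :: 'a set \<Rightarrow> nat. is_mod_iso R E
        (module_direct_sum (minimal_primes R) (\<lambda>P. module_direct_sum {..<n P} (\<lambda>_. EP P)))"
    then obtain n :: "'a set \<Rightarrow> nat" and \<phi> where \<phi>:
      "\<phi> \<in> mod_iso R E (module_direct_sum (minimal_primes R)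
        (\<lambda>P. module_direct_sum {..<n P} (\<lambda>_. EP P)))"
      by (auto simp: is_mod_iso_def)
    show "bi_hopfian R E"
      by (rule finite_sum_of_envelopes_bi_hopfian[OF \<open>injective_module R E\<close> EP \<phi>])
  qed
qed

end
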